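(* Let $y\in\mathcal F_\mathbb Z$ and let $(p,q)$ be a cycle of $y$ with $p<q$. Then $\sum_{z\in\hat\Psi^-(y,p)}\hat F^{\mathrm{FPF}}_z=\sum_{z\in\hat\Psi^+(y,q)}\hat F^{\mathrm{FPF}}_z$.
   Context: Let $S_\mathbb Z$ be the group of finitely supported permutations of $\mathbb Z$, let $s_i=(i,i+1)$, and let $\ell(w)$ be the number of inversions of $w$. Let $\Theta(i)=i-(-1)^i$ and $\mathcal F_\mathbb Z=\{w^{-1}\Theta w:w\in S_\mathbb Z\}$. For $z\in\mathcal F_\mathbb Z$, let $\mathcal A_{\mathrm{FPF}}(z)$ be the set of minimal-length $w$ with $z=w^{-1}\Theta w$. For $w\in S_\mathbb Z$, the Stanley symmetric function is $F_w=\sum_{(a_1,\dots,a_\ell)}\sum x_{i_1}\cdots x_{i_\ell}$. The outer sum is over reduced words $w=s_{a_1}\cdots s_{a_\ell}$. The inner sum is over positive integers $i_1\le\cdots\le i_\ell$ with $i_j<i_{j+1}$ whenever $a_j<a_{j+1}$. Define $\hat F^{\mathrm{FPF}}_z=\sum_{w\in\mathcal A_{\mathrm{FPF}}(z)}F_w$. Let $\hat\ell_{\mathrm{FPF}}(z)=\frac12\#\{(i,j):i<j,\ z(i)>z(j),\ z(i)\ne j\}$. Define $\hat\Psi^+(y,r)=\{z\in\mathcal F_\mathbb Z:\hat\ell_{\mathrm{FPF}}(z)=\hat\ell_{\mathrm{FPF}}(y)+1,\ z=(r,j)y(r,j)\text{ for some integer }j>r\}$ and $\hat\Psi^-(y,r)=\{z\in\mathcal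 F_\mathbb Z:\hat\ell_{\mathrm{FPF}}(z)=\hat\ell_{\mathrm{FPF}}(y)+1,\ z=(i,r)y(i,r)\text{ for some integer }i<r\}$. *)

theory Defs
  imports Complex_Main
begin

definition perm_Z :: "(int \<Rightarrow> int) \<Rightarrow> bool" where
  "perm_Z w \<longleftrightarrow> bij w \<and> finite {i. w i \<noteq> i}"

definition transp_Z :: "int \<Rightarrow> int \<Rightarrow> int \<Rightarrow> int" where
  "transp_Z a b i = (if i = a then b else if i = b then a else i)"

definition s_Z :: "int \<Rightarrow> int \<Rightarrow> int" where
  "s_Z a = transp_Z a (a + 1)"

definition len_Z :: "(int \<Rightarrow> int) \<Rightarrow> nat" where
  "len_Z w = card {(i, j). i < j \<and> w i > w j}"

definition Theta :: "int \<Rightarrow> int" where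
  "Theta i = (if even i then i - 1 else i + 1)"

definition FPF_Z :: "(int \<Rightarrow> int) set" where
  "FPF_Z = {z. \<exists>w. perm_Z w \<and> z = inv w \<circ> Theta \<circ> w}"

definition A_FPF :: "(int \<Rightarrow> int) \<Rightarrow> (int \<Rightarrow> int) set" where
  "A_FPF z = {w. perm_Z w \<and> inv w \<circ> Theta \<circ> w = z \<and>
      (\<forall>v. perm_Z v \<and> inv v \<circ> Theta \<circ> v = z \<longrightarrow> len_Z w \<le> len_Z v)}"

definition word_prod :: "int list \<Rightarrow> int \<Rightarrow> int" where
  "word_prod a = foldr (\<lambda>k f. s_Z k \<circ> f) a id"

definition reduced_word :: "(int \<Rightarrow> int) \<Rightarrow> int list \<Rightarrow> bool" where
  "reduced_word w a \<longleftrightarrow> word_prod a = w \<and> length a = len_Z w"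

definition compatible :: "int list \<Rightarrow> nat list \<Rightarrow> bool" where
  "compatible a i \<longleftrightarrow> length i = length a \<and> (\<forall>k\<in>set i. 0 < k) \<and> sorted i \<and>
     (\<forall>j. Suc j < length a \<longrightarrow> a ! j < a ! Suc j \<longrightarrow> i ! j < i ! Suc j)"

(* Stanley symmetric function F_w, as a formal power series in x_1, x_2, ...:
   coefficient of the monomial prod_k x_k^(alpha k) *)
definition stanley_coeff :: "(int \<Rightarrow> int) \<Rightarrow> (nat \<Rightarrow> nat) \<Rightarrow> nat" where
  "stanley_coeff w \<alpha> = card {(a, i). reduced_word w a \<and> compatible a i \<and>
       (\<forall>k. count_list i k = \<alpha> k)}"

definition FPF_coeff :: "(int \<Rightarrow> int) \<Rightarrow> (nat \<Rightarrow> nat) \<Rightarrow> nat" where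
  "FPF_coeff z \<alpha> = (\<Sum>w\<in>A_FPF z. stanley_coeff w \<alpha>)"

definition ell_FPF :: "(int \<Rightarrow> int) \<Rightarrow> real" where
  "ell_FPF z = of_nat (card {(i, j). i < j \<and> z i > z j \<and> z i \<noteq> j}) / 2"

definition Psi_plus :: "(int \<Rightarrow> int) \<Rightarrow> int \<Rightarrow> (int \<Rightarrow> int) set" where
  "Psi_plus y r = {z \<in> FPF_Z. ell_FPF z = ell_FPF y + 1 \<and>
      (\<exists>j. j > r \<and> z = transp_Z r j \<circ> y \<circ> transp_Z r j)}"

definition Psi_minus :: "(int \<Rightarrow> int) \<Rightarrow> int \<Rightarrow> (int \<Rightarrow> int) set" where
  "Psi_minus y r = {z \<in> FPF_Z. ell_FPF z = ell_FPF y + 1 \<and>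
      (\<exists>i. i < r \<and> z = transp_Z i r \<circ> y \<circ> transp_Z i r)}"

end

theory Submission
  imports Defs
begin

text \<open>
  Removing a letter from the right end of a word acts on fixed-point-free involutions by
  \<open>\<partial>\<^sub>a : z \<mapsto> s\<^sub>a z s\<^sub>a\<close> whenever this lowers the length, and the coefficient of a monomial in the
  symmetric function of \<open>z\<close> is obtained by applying to \<open>z\<close> the product of the operators
  \<open>1 + x\<^sub>k \<partial>\<^sub>a\<close>, with \<open>k\<close> decreasing and, for fixed \<open>k\<close>, with \<open>a\<close> increasing, and then reading off the
  coefficient of \<open>\<Theta>\<close>. For a cycle \<open>c\<close> of \<open>y\<close> let \<open>D\<^sub>c y\<close> be the formal difference of the two sets of
  covers in the theorem. Both sets consist of rematchings of \<open>c\<close> with a second cycle, and the sign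
  records whether that cycle lies to the right or to the left of \<open>c\<close>. A case analysis gives the
  Leibniz rule \<open>\<partial>\<^sub>a D\<^sub>c y = D\<^bsub>s\<^sub>a c\<^esub> \<partial>\<^sub>a y + ([a \<in> c] - [a + 1 \<in> c]) y\<close>, from which
  \<open>D\<^sub>c y - x\<^sub>k [a \<in> c] y\<close> is carried by \<open>1 + x\<^sub>k \<partial>\<^sub>a\<close> to the same expression for \<open>a + 1\<close>. Hence \<open>D\<close>
  commutes with the whole product, and since \<open>D\<close> raises lengths, \<open>\<Theta>\<close> never occurs in its image.
\<close>

section \<open>Inversions\<close>

definition inversions_on :: "int set \<Rightarrow> (int \<Rightarrow> int) \<Rightarrow> (int \<times> int) set" where
  "inversions_on W w = {(i, j). i \<in> W \<and> j \<in> W \<and> i < j \<and> w j < w i}"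

lemma transp_Z_simps [simp]:
  "transp_Z a b a = b" "transp_Z a b b = a"
  "i \<noteq> a \<Longrightarrow> i \<noteq> b \<Longrightarrow> transp_Z a b i = i"
  "transp_Z a b (transp_Z a b i) = i"
  by (auto simp: transp_Z_def)

lemma transp_Z_commute: "transp_Z a b = transp_Z b a"
  by (auto simp: fun_eq_iff transp_Z_def)

lemma inj_transp_Z: "inj (transp_Z a b)"
  by (metis injI transp_Z_simps(4))

lemma inj_transp_Z_eq [simp]: "transp_Z a b i = transp_Z a b j \<longleftrightarrow> i = j"
  using inj_transp_Z by (simp add: inj_eq)

lemma perm_Z_transp: "perm_Z (transp_Z a b)"
proof -
  have "bij (transp_Z a b)"
    by (rule involuntory_imp_bij) simp
  moreover have "{i. transp_Z a b i \<noteq> i} \<subseteq> {a, b}"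
    by (auto simp: transp_Z_def)
  ultimately show ?thesis
    unfolding perm_Z_def using finite_subset by blast
qed

lemma perm_Z_comp:
  assumes "perm_Z v" "perm_Z w"
  shows "perm_Z (v \<circ> w)"
proof -
  have "{i. (v \<circ> w) i \<noteq> i} \<subseteq> {i. v i \<noteq> i} \<union> {i. w i \<noteq> i}"
    by auto
  then show ?thesis
    using assms unfolding perm_Z_def by (meson bij_comp finite_UnI finite_subset)
qed

text \<open>An injection showing that exchanging two increasing entries creates inversions: both
  positions of a pair are relabelled, unless this would reverse their order, in which case the pair
  is kept.\<close>

definition transp_pair :: "int \<Rightarrow> int \<Rightarrow> int \<times> int \<Rightarrow> int \<times> int" where
  "transp_pair i j = (\<lambda>(k, l). if transp_Z i j k < transp_Z i j l
     then (transp_Z i j k, transp_Z i j l) else (k, l))"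

lemma inj_on_transp_pair: "inj_on (transp_pair i j) {(k, l). k < l}"
  by (auto simp: inj_on_def transp_pair_def split: if_splits)

lemma transp_pair_inversions:
  assumes "i < j" "w i < w j" "i \<in> W" "j \<in> W"
  shows "transp_pair i j ` inversions_on W w \<subseteq> inversions_on W (w \<circ> transp_Z i j) - {(i, j)}"
  using assms
  by (auto simp: transp_pair_def inversions_on_def transp_Z_def split: if_splits)

lemma card_inversions_less:
  assumes "i < j" "w i < w j" "i \<in> W" "j \<in> W"
    and fin: "finite (inversions_on W (w \<circ> transp_Z i j))"
  shows "card (inversions_on W w) < card (inversions_on W (w \<circ> transp_Z i j))"
proof -
  let ?I = "inversions_on W (w \<circ> transp_Z i j)"
  have "inversions_on W w \<subseteq> {(k, l). k < l}"
    by (auto simp: inversions_on_def)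
  then have "card (inversions_on W w) = card (transp_pair i j ` inversions_on W w)"
    by (metis card_image inj_on_transp_pair inj_on_subset)
  also have "\<dots> \<le> card (?I - {(i, j)})"
    using transp_pair_inversions[OF assms(1-4)] fin by (intro card_mono) auto
  also have "\<dots> < card ?I"
    using assms by (intro card_Diff1_less fin) (auto simp: inversions_on_def)
  finally show ?thesis .
qed

text \<open>For neighbouring positions \<open>transp_pair\<close> misses only
  \<open>(a, a + 1)\<close>, so the strict inequality of \<open>card_inversions_less\<close>
  sharpens to a gain of exactly one.\<close>

lemma card_inversions_simple:
  assumes "w a < w (a + 1)" "a \<in> W" "a + 1 \<in> W"
    and fin: "finite (inversions_on W w)"
  shows "card (inversions_on W (w \<circ> s_Z a)) = Suc (card (inversions_on W w))"
proof -
  let ?I = "inversions_on W (w \<circ> s_Z a)"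
  have "transp_pair a (a + 1) ` inversions_on W w = ?I - {(a, a + 1)}"
  proof
    show "transp_pair a (a + 1) ` inversions_on W w \<subseteq> ?I - {(a, a + 1)}"
      using transp_pair_inversions[of a "a + 1" w W] assms by (simp add: s_Z_def)
    show "?I - {(a, a + 1)} \<subseteq> transp_pair a (a + 1) ` inversions_on W w"
    proof
      fix x assume x: "x \<in> ?I - {(a, a + 1)}"
      obtain k l where kl: "x = (k, l)" by fastforce
      let ?y = "(s_Z a k, s_Z a l)"
      have "?y \<in> inversions_on W w" "x = transp_pair a (a + 1) ?y"
        using x assms kl
        by (auto simp: inversions_on_def transp_pair_def s_Z_def transp_Z_def split: if_splits)
      then show "x \<in> transp_pair a (a + 1) ` inversions_on W w"
        by blast
    qed
  qed
  moreover have "inversions_on W w \<subseteq> {(k, l). k < l}"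
    by (auto simp: inversions_on_def)
  then have inj: "inj_on (transp_pair a (a + 1)) (inversions_on W w)"
    by (metis inj_on_transp_pair inj_on_subset)
  ultimately have *: "card (inversions_on W w) = card (?I - {(a, a + 1)})"
    and "finite (?I - {(a, a + 1)})"
    using fin by (metis card_image, metis finite_imageI)
  moreover have "(a, a + 1) \<in> ?I"
    using assms by (auto simp: inversions_on_def s_Z_def)
  ultimately show ?thesis
    by (metis card_Suc_Diff1 finite_insert insert_Diff)
qed

text \<open>The two values at an inversion of \<open>g\<close> form an inversion of its inverse
  \<open>h\<close>. This later trades right multiplication by a transposition for left
  multiplication.\<close>

lemma card_inversions_inverse_le:
  assumes "\<And>i. h (g i) = i" "g ` W \<subseteq> W" "finite W"
  shows "card (inversions_on W g) \<le> card (inversions_on W h)"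
proof -
  have "inj_on (\<lambda>(i, j). (g j, g i)) (inversions_on W g)"
    by (rule inj_on_inverseI[where g = "\<lambda>(i, j). (h j, h i)"]) (auto simp: assms)
  moreover have "(\<lambda>(i, j). (g j, g i)) ` inversions_on W g \<subseteq> inversions_on W h"
    using assms by (auto simp: inversions_on_def)
  moreover have "finite (inversions_on W h)"
    by (rule finite_subset[of _ "W \<times> W"]) (auto simp: inversions_on_def assms)
  ultimately show ?thesis
    using card_inj_on_le by blast
qed

lemma card_inversions_inverse:
  assumes "\<And>i. h (g i) = i" "\<And>i. g (h i) = i" "g ` W \<subseteq> W" "h ` W \<subseteq> W" "finite W"
  shows "card (inversions_on W g) = card (inversions_on W h)"
  using card_inversions_inverse_le[of h g W] card_inversions_inverse_le[of g h W] assms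
  by auto

section \<open>Ascents, conjugation, and FPF inversions counted in a finite window\<close>

definition asc_at :: "int \<Rightarrow> (int \<Rightarrow> int) \<Rightarrow> bool" where
  "asc_at a y \<longleftrightarrow> y a < y (a + 1)"

text \<open>Excluding \<open>y a = a + 1\<close> leaves exactly the case in which conjugation by
  \<open>s_Z a\<close> lowers the length; when \<open>a\<close> and \<open>a + 1\<close> are
  matched, conjugation fixes \<open>y\<close>.\<close>

definition desc_at :: "int \<Rightarrow> (int \<Rightarrow> int) \<Rightarrow> bool" where
  "desc_at a y \<longleftrightarrow> y a > y (a + 1) \<and> y a \<noteq> a + 1"

definition conj_t :: "int \<Rightarrow> int \<Rightarrow> (int \<Rightarrow> int) \<Rightarrow> int \<Rightarrow> int" where
  "conj_t i j y = transp_Z i j \<circ> y \<circ> transp_Z i j"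

definition conj_s :: "int \<Rightarrow> (int \<Rightarrow> int) \<Rightarrow> int \<Rightarrow> int" where
  "conj_s a y = s_Z a \<circ> y \<circ> s_Z a"

lemma conj_s_eq_conj_t: "conj_s a = conj_t a (a + 1)"
  by (auto simp: conj_s_def conj_t_def s_Z_def fun_eq_iff)

lemma s_Z_simps [simp]: "s_Z a (s_Z a i) = i" "s_Z a a = a + 1" "s_Z a (a + 1) = a"
  by (auto simp: s_Z_def)

lemma conj_s_conj_s [simp]: "conj_s a (conj_s a y) = y"
  by (auto simp: conj_s_def)

lemma conj_s_apply: "conj_s a y i = s_Z a (y (s_Z a i))"
  by (simp add: conj_s_def)

definition inv_FPF :: "(int \<Rightarrow> int) \<Rightarrow> (int \<times> int) set" where
  "inv_FPF z = {(i, j). i < j \<and> z i > z j \<and> z i \<noteq> j}"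

lemma ell_FPF_inv: "ell_FPF z = of_nat (card (inv_FPF z)) / 2"
  by (simp add: ell_FPF_def inv_FPF_def)

text \<open>The endpoints are chosen so that the interval is a union of cycles
  \<open>{2k - 1, 2k}\<close> of \<open>Theta\<close>.\<close>

definition window :: "nat \<Rightarrow> int set" where
  "window n = {1 - 2 * int n..2 * int n}"

text \<open>Every element of \<open>FPF_Z\<close> satisfies this for all large \<open>n\<close>, so
  that lengths can be counted inside a finite set.\<close>

definition fpf_on :: "nat \<Rightarrow> (int \<Rightarrow> int) \<Rightarrow> bool" where
  "fpf_on n y \<longleftrightarrow> (\<forall>i. y (y i) = i \<and> y i \<noteq> i) \<and> (\<forall>i. i \<notin> window n \<longrightarrow> y i = Theta i)"

lemma finite_window [simp]: "finite (window n)"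
  by (simp add: window_def)

lemma window_mono: "m \<le> n \<Longrightarrow> window m \<subseteq> window n"
  by (auto simp: window_def)

lemma fpf_on_mono: "fpf_on m y \<Longrightarrow> m \<le> n \<Longrightarrow> fpf_on n y"
  using window_mono[of m n] by (auto simp: fpf_on_def)

lemma Theta_Theta [simp]: "Theta (Theta i) = i"
  and Theta_neq [simp]: "Theta i \<noteq> i"
  by (auto simp: Theta_def)

lemma Theta_window [simp]: "Theta i \<in> window n \<longleftrightarrow> i \<in> window n"
  unfolding Theta_def window_def by (cases "even i"; simp; presburger)

lemma fpf_on_window:
  assumes "fpf_on n y"
  shows "y i \<in> window n \<longleftrightarrow> i \<in> window n"
  using assms by (metis Theta_window fpf_on_def)

lemma in_window_large: "nat \<bar>i\<bar> + 1 \<le> n \<Longrightarrow> i \<in> window n"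
  by (auto simp: window_def)

lemma perm_Z_inv: "perm_Z w \<Longrightarrow> inv w (w i) = i" "perm_Z w \<Longrightarrow> w (inv w i) = i"
  by (auto simp: perm_Z_def bij_is_inj bij_is_surj surj_f_inv_f)

lemma perm_Z_window:
  assumes "perm_Z w"
  obtains n where "\<And>i. i \<notin> window n \<Longrightarrow> w i = i"
    "\<And>i. w i \<in> window n \<longleftrightarrow> i \<in> window n"
proof -
  let ?S = "{i. w i \<noteq> i}"
  have fin: "finite ((\<lambda>i. nat \<bar>i\<bar> + 1) ` ?S)"
    using assms by (simp add: perm_Z_def)
  define n where "n = Max (insert 0 ((\<lambda>i. nat \<bar>i\<bar> + 1) ` ?S))"
  have *: "w i = i" if "i \<notin> window n" for i
  proof (rule ccontr)
    assume "w i \<noteq> i"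
    then have "nat \<bar>i\<bar> + 1 \<le> n"
      unfolding n_def using fin by (intro Max_ge) auto
    then show False
      using that in_window_large by blast
  qed
  moreover have "w i \<in> window n \<longleftrightarrow> i \<in> window n" for i
    by (metis * assms perm_Z_inv(1))
  ultimately show thesis using that by blast
qed

lemma FPF_Z_fpf_on:
  assumes "y \<in> FPF_Z"
  obtains n where "fpf_on n y"
proof -
  obtain w where w: "perm_Z w" "y = inv w \<circ> Theta \<circ> w"
    using assms by (auto simp: FPF_Z_def)
  obtain n where n: "\<And>i. i \<notin> window n \<Longrightarrow> w i = i"
    "\<And>i. w i \<in> window n \<longleftrightarrow> i \<in> window n"
    using perm_Z_window[OF w(1)] by blast
  have "fpf_on n y"
    unfolding fpf_on_def
  proof (intro conjI allI impI)
    fix i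
    show "y (y i) = i" "y i \<noteq> i"
      using w by (auto simp: perm_Z_inv) (metis Theta_neq perm_Z_inv(2))
    assume "i \<notin> window n"
    then have "w i = i" "w (Theta i) = Theta i"
      using n(1) by auto
    then show "y i = Theta i"
      using w by (metis comp_apply perm_Z_inv(1))
  qed
  then show thesis using that by blast
qed

lemma FPF_Z_invol: "y \<in> FPF_Z \<Longrightarrow> y (y i) = i" and FPF_Z_neq: "y \<in> FPF_Z \<Longrightarrow> y i \<noteq> i"
  by (metis FPF_Z_fpf_on fpf_on_def)+

lemma FPF_Z_eq_iff: "y \<in> FPF_Z \<Longrightarrow> y i = y j \<longleftrightarrow> i = j"
  by (metis FPF_Z_invol)

lemma FPF_Z_conj_t [simp]:
  assumes "y \<in> FPF_Z"
  shows "conj_t i j y \<in> FPF_Z"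
proof -
  obtain w where w: "perm_Z w" "y = inv w \<circ> Theta \<circ> w"
    using assms by (auto simp: FPF_Z_def)
  have "inv (w \<circ> transp_Z i j) = transp_Z i j \<circ> inv w"
    by (rule inv_unique_comp) (auto simp: fun_eq_iff perm_Z_inv[OF w(1)])
  then have "conj_t i j y = inv (w \<circ> transp_Z i j) \<circ> Theta \<circ> (w \<circ> transp_Z i j)"
    by (simp add: conj_t_def w comp_assoc)
  then show ?thesis
    using perm_Z_comp[OF w(1) perm_Z_transp] by (auto simp: FPF_Z_def)
qed

lemma FPF_Z_conj_s [simp]: "y \<in> FPF_Z \<Longrightarrow> conj_s a y \<in> FPF_Z"
  by (simp add: conj_s_eq_conj_t)

lemma Theta_FPF: "Theta \<in> FPF_Z"
  unfolding FPF_Z_def by (auto simp: perm_Z_def intro!: exI[of _ id])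

lemma transp_Z_window:
  "i \<in> window n \<Longrightarrow> j \<in> window n \<Longrightarrow> transp_Z i j k \<in> window n \<longleftrightarrow> k \<in> window n"
  by (auto simp: transp_Z_def)

lemma fpf_on_conj_t:
  assumes "fpf_on n y" "i \<in> window n" "j \<in> window n"
  shows "fpf_on n (conj_t i j y)"
proof -
  have "conj_t i j y k = Theta k" if "k \<notin> window n" for k
  proof -
    have "transp_Z i j k = k" "transp_Z i j (Theta k) = Theta k"
      using that assms Theta_window[of k n] by (auto simp: transp_Z_def)
    then show ?thesis
      using assms that by (simp add: conj_t_def fpf_on_def)
  qed
  moreover have "conj_t i j y k \<noteq> k" for k
  proof -
    have "y (transp_Z i j k) \<noteq> transp_Z i j k"
      using assms by (simp add: fpf_on_def)
    then show ?thesis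
      unfolding conj_t_def comp_apply by (metis transp_Z_simps(4))
  qed
  moreover have "conj_t i j y (conj_t i j y k) = k" for k
    using assms by (simp add: fpf_on_def conj_t_def)
  ultimately show ?thesis
    unfolding fpf_on_def by blast
qed

lemma Theta_inversion: "i < j \<Longrightarrow> Theta j < Theta i \<Longrightarrow> Theta i = j"
  unfolding Theta_def by presburger

lemma Theta_bounds: "Theta i \<le> i + 1" "i - 1 \<le> Theta i"
  by (auto simp: Theta_def)

text \<open>Two positions outside the window form an inversion only if they are a cycle of
  \<open>Theta\<close>, which \<open>inv_FPF\<close> discards. A position outside moves by at most
  one and stays outside, hence keeps its order relative to the positions inside.\<close>

lemma inv_FPF_window:
  assumes "fpf_on n y"
  shows "inv_FPF y \<subseteq> window n \<times> window n"
proof (clarsimp simp: inv_FPF_def)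
  fix i j assume ij: "i < j" "y j < y i" "y i \<noteq> j"
  have out: "k \<notin> window n \<Longrightarrow> y k = Theta k" for k
    using assms by (simp add: fpf_on_def)
  have "y i \<noteq> Theta i \<or> y j \<noteq> Theta j"
    using ij Theta_inversion by auto
  then have "i \<in> window n \<or> j \<in> window n"
    using out by auto
  moreover have False if "i \<in> window n" "j \<notin> window n"
  proof -
    have "Theta j \<notin> window n" "y j = Theta j" "y i \<in> window n"
      using that out fpf_on_window[OF assms] by auto
    then show False using that ij(1,2) Theta_bounds[of j] by (auto simp: window_def)
  qed
  moreover have False if "j \<in> window n" "i \<notin> window n"
  proof -
    have "Theta i \<notin> window n" "y i = Theta i" "y j \<in> window n"
      using that out fpf_on_window[OF assms] by auto
    then show False using that ij(1,2) Theta_bounds[of i] by (auto simp: window_def)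
  qed
  ultimately show "i \<in> window n \<and> j \<in> window n" by blast
qed

lemma finite_inv_FPF:
  assumes "y \<in> FPF_Z"
  shows "finite (inv_FPF y)"
proof -
  obtain n where "fpf_on n y" using FPF_Z_fpf_on[OF assms] .
  then show ?thesis
    by (intro finite_subset[OF inv_FPF_window]) auto
qed

text \<open>The ordinary inversions are the FPF inversions together with one pair
  \<open>(i, y i)\<close> per cycle, and there are half as many cycles as points. The results on
  ordinary inversions thereby apply to \<open>inv_FPF\<close>.\<close>

lemma card_inversions_window:
  assumes y: "fpf_on n y"
  shows "2 * card (inversions_on (window n) y) = 2 * card (inv_FPF y) + card (window n)"
proof -
  let ?W = "window n"
  let ?A = "{i \<in> ?W. i < y i}" and ?B = "{i \<in> ?W. y i < i}"
  let ?X = "(\<lambda>i. (i, y i)) ` ?A"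
  have inv: "y (y i) = i" "y i \<noteq> i" for i
    using y by (auto simp: fpf_on_def)
  have "inversions_on ?W y = inv_FPF y \<union> ?X"
  proof (intro set_eqI iffI)
    fix x assume "x \<in> inversions_on ?W y"
    then show "x \<in> inv_FPF y \<union> ?X"
      by (auto simp: inversions_on_def inv_FPF_def)
  next
    fix x assume "x \<in> inv_FPF y \<union> ?X"
    then show "x \<in> inversions_on ?W y"
      using inv_FPF_window[OF y] inv(1) fpf_on_window[OF y]
      by (auto simp: inversions_on_def inv_FPF_def)
  qed
  moreover have "inv_FPF y \<inter> ?X = {}"
    by (auto simp: inv_FPF_def)
  moreover have "finite (inv_FPF y)"
    by (intro finite_subset[OF inv_FPF_window[OF y]]) auto
  ultimately have 1: "card (inversions_on ?W y) = card (inv_FPF y) + card ?X"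
    by (simp add: card_Un_disjoint)
  have "card ?X = card ?A"
    by (intro card_image) (auto simp: inj_on_def)
  moreover have "bij_betw y ?A ?B"
    by (rule bij_betw_byWitness[where f' = y]) (auto simp: inv fpf_on_window[OF y])
  then have "card ?A = card ?B" by (rule bij_betw_same_card)
  moreover have "card ?W = card ?A + card ?B"
  proof -
    have "?W = ?A \<union> ?B" using inv by (auto simp: neq_iff)
    moreover have "?A \<inter> ?B = {}" by auto
    ultimately show ?thesis
      by (metis card_Un_disjoint finite_Un finite_window)
  qed
  ultimately show ?thesis using 1 by simp
qed

lemma finite_inversions_window [simp]: "finite (inversions_on (window n) w)"
  by (rule finite_subset[of _ "window n \<times> window n"]) (auto simp: inversions_on_def)

lemma fpf_on_large:
  assumes y: "y \<in> FPF_Z"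
  obtains n where "fpf_on n y" "i \<in> window n" "j \<in> window n"
proof -
  obtain m where m: "fpf_on m y"
    using FPF_Z_fpf_on[OF y] .
  define n where "n = m + (nat \<bar>i\<bar> + 1) + (nat \<bar>j\<bar> + 1)"
  have "fpf_on n y" "i \<in> window n" "j \<in> window n"
    by (rule fpf_on_mono[OF m] in_window_large; simp add: n_def)+
  then show thesis by (rule that)
qed

text \<open>Conjugation is split into two one-sided multiplications, each of which strictly raises
  the number of inversions. Since \<open>y\<close> is an involution, \<open>y \<circ> t\<close> and
  \<open>t \<circ> y\<close> are mutually inverse and have equally many inversions.\<close>

lemma card_inv_FPF_conj_t:
  assumes y: "y \<in> FPF_Z" and "i < j" "y i < y j" "transp_Z i j (y i) < transp_Z i j (y j)"
  shows "card (inv_FPF y) + 2 \<le> card (inv_FPF (conj_t i j y))"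
proof -
  obtain n where n: "fpf_on n y" "i \<in> window n" "j \<in> window n"
    using fpf_on_large[OF y] .
  let ?t = "transp_Z i j" and ?I = "\<lambda>w. card (inversions_on (window n) w)"
  have "?I y < ?I (y \<circ> ?t)"
    using assms n by (intro card_inversions_less) auto
  also have "\<dots> = ?I (?t \<circ> y)"
    using fpf_on_window[OF n(1)] transp_Z_window[OF n(2,3)] FPF_Z_invol[OF y]
    by (intro card_inversions_inverse) auto
  finally have "?I y < ?I (?t \<circ> y)" .
  moreover have "?I (?t \<circ> y) < ?I (?t \<circ> y \<circ> ?t)"
    using assms n by (intro card_inversions_less) auto
  ultimately show ?thesis
    using card_inversions_window[OF n(1)] card_inversions_window[OF fpf_on_conj_t[OF n]]
    by (simp add: conj_t_def)
qed

lemma card_inv_FPF_asc: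
  assumes y: "y \<in> FPF_Z" and asc: "asc_at a y"
  shows "card (inv_FPF (conj_s a y)) = card (inv_FPF y) + 2"
proof -
  obtain n where n: "fpf_on n y" "a \<in> window n" "a + 1 \<in> window n"
    using fpf_on_large[OF y] .
  let ?I = "\<lambda>w. card (inversions_on (window n) w)"
  \<comment> \<open>The inequality could be reversed only by \<open>y a = a\<close> and
    \<open>y (a + 1) = a + 1\<close>, but \<open>y\<close> has no fixed points.\<close>
  have "s_Z a (y a) < s_Z a (y (a + 1))"
    using asc FPF_Z_neq[OF y, of a] by (auto simp: s_Z_def transp_Z_def asc_at_def)
  then have "?I (s_Z a \<circ> y \<circ> s_Z a) = Suc (?I (s_Z a \<circ> y))"
    using n by (intro card_inversions_simple) auto
  also have "?I (s_Z a \<circ> y) = ?I (y \<circ> s_Z a)"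
    using fpf_on_window[OF n(1)] transp_Z_window[OF n(2,3)] FPF_Z_invol[OF y]
    by (intro card_inversions_inverse) (auto simp: s_Z_def)
  also have "?I (y \<circ> s_Z a) = Suc (?I y)"
    using n asc by (intro card_inversions_simple) (auto simp: asc_at_def)
  finally show ?thesis
    using card_inversions_window[OF n(1)] card_inversions_window[OF fpf_on_conj_t[OF n]]
    by (simp add: conj_s_eq_conj_t[symmetric] conj_s_def comp_def)
qed

section \<open>Covers obtained by rematching two cycles\<close>

lemma asc_at_conj_s:
  assumes "y \<in> FPF_Z"
  shows "asc_at a (conj_s a y) \<longleftrightarrow> desc_at a y"
proof -
  have "y a \<noteq> a" "y (a + 1) \<noteq> a + 1" "y a \<noteq> y (a + 1)" "y a = a + 1 \<longleftrightarrow> y (a + 1) = a"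
    using FPF_Z_neq[OF assms] FPF_Z_eq_iff[OF assms] FPF_Z_invol[OF assms, of a]
      FPF_Z_invol[OF assms, of "a + 1"] by auto
  then show ?thesis
    by (auto simp: asc_at_def desc_at_def conj_s_apply s_Z_def transp_Z_def)
qed

lemma desc_at_conj_s: "y \<in> FPF_Z \<Longrightarrow> desc_at a (conj_s a y) \<longleftrightarrow> asc_at a y"
  using asc_at_conj_s[of "conj_s a y" a] by simp

lemma card_inv_FPF_desc:
  assumes "y \<in> FPF_Z" "desc_at a y"
  shows "card (inv_FPF y) = card (inv_FPF (conj_s a y)) + 2"
  using card_inv_FPF_asc[of "conj_s a y" a] assms by (simp add: asc_at_conj_s)

lemma not_asc_not_desc:
  assumes "y \<in> FPF_Z" "\<not> asc_at a y" "\<not> desc_at a y"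
  shows "y a = a + 1" "conj_s a y = y"
proof -
  have "y a \<noteq> y (a + 1)"
    using FPF_Z_eq_iff[OF assms(1)] by simp
  then show *: "y a = a + 1"
    using assms by (auto simp: asc_at_def desc_at_def)
  then have "y (a + 1) = a"
    using FPF_Z_invol[OF assms(1), of a] by simp
  moreover have "y i \<noteq> a" "y i \<noteq> a + 1" if "i \<noteq> a" "i \<noteq> a + 1" for i
    using that * \<open>y (a + 1) = a\<close> FPF_Z_eq_iff[OF assms(1), of i "a + 1"]
      FPF_Z_eq_iff[OF assms(1), of i a] by auto
  ultimately show "conj_s a y = y"
    using * by (auto simp: fun_eq_iff conj_s_apply s_Z_def transp_Z_def)
qed

lemma asc_not_desc: "asc_at a y \<Longrightarrow> \<not> desc_at a y"
  by (simp add: asc_at_def desc_at_def)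

text \<open>Both conjugations replace the cycles \<open>{i, y i}\<close> and \<open>{j, y j}\<close>
  by \<open>{i, y j}\<close> and \<open>{j, y i}\<close>.\<close>

lemma conj_t_swap:
  assumes y: "y \<in> FPF_Z" and "j \<noteq> i" "j \<noteq> y i"
  shows "conj_t (y i) (y j) y = conj_t i j y"
proof
  fix k
  have inv: "y k = l \<longleftrightarrow> k = y l" for k l
    using FPF_Z_invol[OF y] by metis
  have "y i \<noteq> i" "y j \<noteq> j" "y (y i) = i" "y (y j) = j"
    using FPF_Z_neq[OF y] FPF_Z_invol[OF y] by simp_all
  moreover have "y i \<noteq> y j" "i \<noteq> y j"
    using assms(2,3) FPF_Z_eq_iff[OF y] inv[of i j] by auto
  moreover have "y k = i \<longleftrightarrow> k = y i" "y k = j \<longleftrightarrow> k = y j"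
    by (rule inv)+
  moreover have "y k = y i \<longleftrightarrow> k = i" "y k = y j \<longleftrightarrow> k = j"
    by (rule FPF_Z_eq_iff[OF y])+
  ultimately show "conj_t (y i) (y j) y k = conj_t i j y k"
    using assms(2,3) by (auto simp: conj_t_def transp_Z_def)
qed

lemma conj_s_conj_t: "conj_s a (conj_t i j y) = conj_t (s_Z a i) (s_Z a j) (conj_s a y)"
proof -
  have *: "transp_Z (s_Z a i) (s_Z a j) (s_Z a k) = s_Z a (transp_Z i j k)" for k
    unfolding transp_Z_def[of _ _ k] transp_Z_def[of _ _ "s_Z a k"] by (simp add: s_Z_def)
  have "transp_Z (s_Z a i) (s_Z a j) k = s_Z a (transp_Z i j (s_Z a k))" for k
    using *[of "s_Z a k"] by simp
  then show ?thesis
    unfolding conj_s_def conj_t_def fun_eq_iff comp_apply by (simp only: s_Z_simps simp_thms)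
qed

text \<open>
  For \<open>q < u\<close> the separated cycles \<open>(p q)(u v)\<close> become the crossing ones \<open>(p u)(q v)\<close>; otherwise the
  crossing cycles \<open>(p q)(u v)\<close> become the nested ones \<open>(p v)(u q)\<close>.
\<close>

definition up_move :: "(int \<Rightarrow> int) \<Rightarrow> int \<Rightarrow> int \<Rightarrow> int \<Rightarrow> int \<Rightarrow> (int \<Rightarrow> int) \<Rightarrow> bool" where
  "up_move y p q u v z \<longleftrightarrow> y p = q \<and> y u = v \<and> p < q \<and> u < v \<and> p < u \<and> q < v \<and>
     z = conj_t q (if q < u then u else v) y"

lemma up_move_values:
  assumes y: "y \<in> FPF_Z" and z: "up_move y p q u v z"
  shows "y p = q" "y q = p" "y u = v" "y v = u" "u \<noteq> q"
    "z p = (if q < u then u else v)" "z q = (if q < u then v else u)"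
    "z u = (if q < u then p else q)" "z v = (if q < u then q else p)"
    "i \<notin> {p, q, u, v} \<Longrightarrow> z i = y i"
proof -
  show v: "y p = q" "y q = p" "y u = v" "y v = u"
    using z FPF_Z_invol[OF y] by (auto simp: up_move_def)
  have n: "p < q" "u < v" "p < u" "q < v"
    using z by (auto simp: up_move_def)
  show "u \<noteq> q"
    using v n by auto
  then show "z p = (if q < u then u else v)" "z q = (if q < u then v else u)"
    "z u = (if q < u then p else q)" "z v = (if q < u then q else p)"
    using z v n by (auto simp: up_move_def conj_t_def transp_Z_def)
  assume i: "i \<notin> {p, q, u, v}"
  then have "y i \<notin> {p, q, u, v}"
    using v FPF_Z_invol[OF y, of i] by auto
  then show "z i = y i"
    using i z by (auto simp: up_move_def conj_t_def)
qed

lemma up_move_FPF: "y \<in> FPF_Z \<Longrightarrow> up_move y p q u v z \<Longrightarrow> z \<in> FPF_Z"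
  by (auto simp: up_move_def)

lemma card_inv_FPF_up_move:
  assumes y: "y \<in> FPF_Z" and z: "up_move y p q u v z"
  shows "card (inv_FPF y) + 2 \<le> card (inv_FPF z)"
proof -
  note v = up_move_values(1-5)[OF y z]
  have n: "p < q" "u < v" "p < u" "q < v" "z = conj_t q (if q < u then u else v) y"
    using z by (auto simp: up_move_def)
  show ?thesis
    unfolding n(5) using n v by (intro card_inv_FPF_conj_t y) auto
qed

lemma s_Z_less: "i < j \<Longrightarrow> \<not> (i = a \<and> j = a + 1) \<Longrightarrow> s_Z a i < s_Z a j"
  by (auto simp: s_Z_def transp_Z_def)

text \<open>\<open>s_Z a\<close> preserves the order of any two integers other than the pair
  \<open>a\<close>, \<open>a + 1\<close>, so the relative position of the four endpoints
  survives.\<close>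

lemma up_move_conj_s:
  assumes y: "y \<in> FPF_Z" and z: "up_move y p q u v z"
    and E: "\<not> {a, a + 1} \<subseteq> {p, q, u, v}"
  shows "up_move (conj_s a y) (s_Z a p) (s_Z a q) (s_Z a u) (s_Z a v) (conj_s a z)"
proof -
  have less: "s_Z a i < s_Z a j \<longleftrightarrow> i < j" if "{i, j} \<subseteq> {p, q, u, v}" for i j
    using s_Z_less[of i j a] s_Z_less[of j i a] that E
    by (cases i j rule: linorder_cases) auto
  show ?thesis
    using z unfolding up_move_def by (auto simp: less conj_s_apply conj_s_conj_t)
qed

section \<open>Covers and their conjugates by simple transpositions\<close>

definition cover :: "(int \<Rightarrow> int) \<Rightarrow> int \<Rightarrow> int \<Rightarrow> int \<Rightarrow> int \<Rightarrow> (int \<Rightarrow> int) \<Rightarrow> bool" where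
  "cover y p q u v z \<longleftrightarrow> up_move y p q u v z \<and> card (inv_FPF z) = card (inv_FPF y) + 2"

text \<open>Here \<open>a\<close> and \<open>a + 1\<close> are neighbours among the four ordered
  endpoints, which leaves three cases for each type of move. An ascent occurs exactly when an
  endpoint of the left cycle is followed by one of the right cycle, and then the move is itself
  conjugation by \<open>s_Z a\<close>.\<close>

lemma up_move_adjacent:
  assumes y: "y \<in> FPF_Z" and z: "up_move y p q u v z" and E: "{a, a + 1} \<subseteq> {p, q, u, v}"
  shows "asc_at a y \<Longrightarrow> desc_at a z \<and> z = conj_s a y \<and> a \<in> {p, q} \<and> a + 1 \<in> {u, v}"
    and "\<not> asc_at a y \<Longrightarrow> \<not> desc_at a z"
proof -
  note v = up_move_values(1-9)[OF y z]
  have n: "p < q" "u < v" "p < u" "q < v"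
    and zt: "z = conj_t q (if q < u then u else v) y"
    using z by (auto simp: up_move_def)
  have swap: "conj_t q v y = conj_t p u y"
    using conj_t_swap[OF y, of u p] v n by auto
  have pos: "(a = p \<or> a = q \<or> a = u \<or> a = v) \<and> (a + 1 = p \<or> a + 1 = q \<or> a + 1 = u \<or> a + 1 = v)"
    using E by auto
  have "(\<not> asc_at a y \<and> \<not> desc_at a z) \<or> (asc_at a y \<and> desc_at a z \<and>
    ((q < u \<and> a = q \<and> a + 1 = u) \<or> (u < q \<and> (a = p \<and> a + 1 = u \<or> a = q \<and> a + 1 = v))))"
    (is ?P)
  proof (cases "q < u")
    case True
    have "a = p \<and> a + 1 = q \<or> a = q \<and> a + 1 = u \<or> a = u \<and> a + 1 = v"
      using pos n True by (elim disjE conjE) linarith+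
    moreover have "z p = u" "z q = v" "z u = p" "z v = q" using v True by simp_all
    ultimately have "(y a = q \<and> y (a + 1) = p \<and> z a = u \<and> z (a + 1) = v) \<or>
      (y a = p \<and> y (a + 1) = v \<and> z a = v \<and> z (a + 1) = p \<and> a = q \<and> a + 1 = u) \<or>
      (y a = v \<and> y (a + 1) = u \<and> z a = p \<and> z (a + 1) = q)"
      using v(1-4) by (elim disjE conjE) (simp only: simp_thms)+
    then show ?P
      unfolding asc_at_def desc_at_def using True n by (elim disjE conjE) simp_all
  next
    case False
    have "a = p \<and> a + 1 = u \<or> a = u \<and> a + 1 = q \<or> a = q \<and> a + 1 = v"
      using pos n v(5) False by (elim disjE conjE) linarith+
    moreover have "z p = v" "z q = u" "z u = q" "z v = p" using v False by simp_all
    ultimately have "(y a = q \<and> y (a + 1) = v \<and> z a = v \<and> z (a + 1) = q \<and> a = p \<and> a + 1 = u) \<or>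
      (y a = v \<and> y (a + 1) = p \<and> z a = q \<and> z (a + 1) = u \<and> a + 1 = q) \<or>
      (y a = p \<and> y (a + 1) = u \<and> z a = u \<and> z (a + 1) = p \<and> a = q \<and> a + 1 = v)"
      using v(1-4) by (elim disjE conjE) (simp only: simp_thms)+
    then show ?P
      unfolding asc_at_def desc_at_def using False n v(5) by (elim disjE conjE) simp_all
  qed
  moreover have "z = conj_s a y" if "a = q \<and> a + 1 = u" "q < u"
    unfolding conj_s_eq_conj_t zt using that by auto
  moreover have "z = conj_s a y" if "a = p \<and> a + 1 = u \<or> a = q \<and> a + 1 = v" "u < q"
  proof -
    have "z = conj_t q v y"
      unfolding zt using that(2) by simp
    then show ?thesis
      unfolding conj_s_eq_conj_t using that(1) swap by (elim disjE conjE) (metis, metis)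
  qed
  ultimately show "asc_at a y \<Longrightarrow> desc_at a z \<and> z = conj_s a y \<and> a \<in> {p, q} \<and> a + 1 \<in> {u, v}"
    and "\<not> asc_at a y \<Longrightarrow> \<not> desc_at a z"
    by blast+
qed

text \<open>An exchange argument. If \<open>a\<close> and \<open>a + 1\<close> are not both
  endpoints, conjugating gives a move from \<open>conj_s a y\<close> to \<open>conj_s a z\<close>.
  But \<open>conj_s a y\<close> is one step longer than \<open>y\<close>, while
  \<open>conj_s a z\<close> is only as long as \<open>y\<close>, and moves raise the length.\<close>

lemma cover_asc:
  assumes y: "y \<in> FPF_Z" and z: "cover y p q u v z" and asc: "asc_at a y" "\<not> asc_at a z"
  shows "z = conj_s a y \<and> a \<in> {p, q} \<and> a + 1 \<in> {u, v}"
proof (cases "{a, a + 1} \<subseteq> {p, q, u, v}")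
  case True
  then show ?thesis
    using up_move_adjacent(1)[OF y _ True asc(1)] z by (auto simp: cover_def)
next
  case False
  have up: "up_move y p q u v z" and card: "card (inv_FPF z) = card (inv_FPF y) + 2"
    using z by (auto simp: cover_def)
  have zF: "z \<in> FPF_Z"
    using up_move_FPF[OF y up] .
  \<comment> \<open>A cycle \<open>{a, a + 1}\<close> of \<open>z\<close> with an endpoint of the
    move would have both its points among the endpoints. Otherwise it is already a cycle of
    \<open>y\<close>, against the ascent.\<close>
  have "z a \<noteq> a + 1"
  proof
    assume za: "z a = a + 1"
    then have "z (a + 1) = a"
      using FPF_Z_invol[OF zF, of a] by simp
    moreover have "a \<notin> {p, q, u, v} \<and> a + 1 \<notin> {p, q, u, v}"
      using za False up_move_values(6-9)[OF y up] \<open>z (a + 1) = a\<close>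
      by (auto split: if_splits)
    ultimately show False
      using asc za up_move_values(10)[OF y up] by (auto simp: asc_at_def)
  qed
  then have "desc_at a z"
    using not_asc_not_desc(1)[OF zF asc(2)] by auto
  then have "card (inv_FPF z) = card (inv_FPF (conj_s a z)) + 2"
    using card_inv_FPF_desc[OF zF] by simp
  moreover have "card (inv_FPF (conj_s a y)) = card (inv_FPF y) + 2"
    using card_inv_FPF_asc[OF y asc(1)] .
  moreover have "card (inv_FPF (conj_s a y)) + 2 \<le> card (inv_FPF (conj_s a z))"
    using card_inv_FPF_up_move[OF _ up_move_conj_s[OF y up False]] y by simp
  ultimately show ?thesis
    using card by simp
qed

lemma cover_conj_s_asc:
  assumes y: "y \<in> FPF_Z" and asc: "asc_at a y"
  obtains p q u v where "cover y p q u v (conj_s a y)" "a \<in> {p, q}" "a + 1 \<in> {u, v}"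
proof -
  have less: "y a < y (a + 1)"
    using asc by (simp add: asc_at_def)
  have inv: "y (y i) = i" "y i \<noteq> i" for i
    using FPF_Z_invol[OF y] FPF_Z_neq[OF y] by auto
  have ne: "y a \<noteq> a + 1" "y (a + 1) \<noteq> a"
    using less inv(1)[of a] inv(1)[of "a + 1"] by auto
  have swap: "conj_t (y a) (y (a + 1)) y = conj_t a (a + 1) y"
    using conj_t_swap[OF y, of "a + 1" a] ne by auto
  let ?p = "min a (y a)" and ?q = "max a (y a)"
    and ?u = "min (a + 1) (y (a + 1))" and ?v = "max (a + 1) (y (a + 1))"
  have "up_move y ?p ?q ?u ?v (conj_s a y)"
    unfolding up_move_def conj_s_eq_conj_t
    using less inv[of a] inv[of "a + 1"] ne swap
    by (auto simp: min_def max_def)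
  then have "cover y ?p ?q ?u ?v (conj_s a y)"
    using card_inv_FPF_asc[OF assms] by (simp add: cover_def)
  then show thesis
    by (rule that) (auto simp: min_def max_def)
qed

text \<open>A common ascent or descent rules out that \<open>a\<close> and \<open>a + 1\<close> are
  both endpoints, by \<open>up_move_adjacent\<close>. So the move commutes with conjugation, and
  both lengths shift by the same amount.\<close>

lemma cover_conj_s:
  assumes y: "y \<in> FPF_Z" and z: "cover y p q u v z"
    and a: "desc_at a y \<and> desc_at a z \<or> asc_at a y \<and> asc_at a z"
  shows "cover (conj_s a y) (s_Z a p) (s_Z a q) (s_Z a u) (s_Z a v) (conj_s a z)"
proof -
  have up: "up_move y p q u v z" and card: "card (inv_FPF z) = card (inv_FPF y) + 2"
    using z by (auto simp: cover_def)
  have zF: "z \<in> FPF_Z"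
    using up_move_FPF[OF y up] .
  have "\<not> {a, a + 1} \<subseteq> {p, q, u, v}"
    using up_move_adjacent[OF y up, of a] a asc_not_desc by blast
  moreover have "card (inv_FPF (conj_s a z)) = card (inv_FPF (conj_s a y)) + 2"
    using a card card_inv_FPF_asc[OF y, of a] card_inv_FPF_asc[OF zF, of a]
      card_inv_FPF_desc[OF y, of a] card_inv_FPF_desc[OF zF, of a] by auto
  ultimately show ?thesis
    using up_move_conj_s[OF y up] by (simp add: cover_def)
qed

text \<open>
  The flag selects whether the marked cycle \<open>{r, y r}\<close> is the left or the right one of the two
  cycles that are rematched.
\<close>

definition covers :: "bool \<Rightarrow> (int \<Rightarrow> int) \<Rightarrow> int \<Rightarrow> (int \<Rightarrow> int) set" where
  "covers b y r = {z. \<exists>p q u v. cover y p q u v z \<and> r \<in> (if b then {p, q} else {u, v})}"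

lemma coversI:
  "cover y p q u v z \<Longrightarrow> r \<in> (if b then {p, q} else {u, v}) \<Longrightarrow> z \<in> covers b y r"
  by (auto simp only: covers_def)

lemma covers_FPF: "y \<in> FPF_Z \<Longrightarrow> z \<in> covers b y r \<Longrightarrow> z \<in> FPF_Z"
  unfolding covers_def cover_def using up_move_FPF by blast

lemma cover_cycle:
  assumes y: "y \<in> FPF_Z" and z: "cover y p q u v z"
  shows "r \<in> {p, q} \<Longrightarrow> {r, y r} = {p, q}" "r \<in> {u, v} \<Longrightarrow> {r, y r} = {u, v}"
  using up_move_values(1-4)[OF y] z by (auto simp: cover_def)

text \<open>The only cover that loses the ascent is \<open>conj_s a y\<close>, whose left cycle
  passes through \<open>a\<close> and whose right cycle passes through \<open>a + 1\<close>. The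
  flag decides which of the two must be the marked one.\<close>

lemma covers_not_asc:
  assumes y: "y \<in> FPF_Z" and asc: "asc_at a y"
  shows "{z \<in> covers b y r. \<not> asc_at a z} =
    (if (if b then a else a + 1) \<in> {r, y r} then {conj_s a y} else {})" (is "?L = ?R")
proof
  show "?L \<subseteq> ?R"
  proof
    fix z assume "z \<in> ?L"
    then obtain p q u v where z: "cover y p q u v z" "r \<in> (if b then {p, q} else {u, v})"
      and "\<not> asc_at a z"
      by (auto simp: covers_def)
    then have "z = conj_s a y" "a \<in> {p, q}" "a + 1 \<in> {u, v}"
      using cover_asc[OF y z(1) asc] by auto
    then show "z \<in> ?R"
      using cover_cycle[OF y z(1), of r] z(2) by (cases b) auto
  qed
  show "?R \<subseteq> ?L"
  proof (cases "(if b then a else a + 1) \<in> {r, y r}")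
    case True
    obtain p q u v where z: "cover y p q u v (conj_s a y)" "a \<in> {p, q}" "a + 1 \<in> {u, v}"
      using cover_conj_s_asc[OF y asc] .
    have "r \<in> (if b then {p, q} else {u, v})"
      using True z cover_cycle(1)[OF y z(1), of a] cover_cycle(2)[OF y z(1), of "a + 1"]
        FPF_Z_invol[OF y, of r] by (auto split: if_splits)
    then have "conj_s a y \<in> covers b y r"
      using z(1) by (rule coversI[rotated])
    moreover have "\<not> asc_at a (conj_s a y)"
      using asc asc_not_desc asc_at_conj_s[OF y] by blast
    ultimately show ?thesis
      using True by auto
  qed auto
qed

lemma covers_conj_s:
  assumes y: "y \<in> FPF_Z" and desc: "desc_at a y"
  shows "conj_s a ` {z \<in> covers b y r. desc_at a z} = {z \<in> covers b (conj_s a y) (s_Z a r). asc_at a z}"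
    (is "?L = ?R")
proof
  have y': "conj_s a y \<in> FPF_Z" "asc_at a (conj_s a y)"
    using y desc by (simp_all add: asc_at_conj_s)
  have "conj_s a z \<in> covers b (conj_s a y) (s_Z a r) \<and> asc_at a (conj_s a z)"
    if z: "z \<in> covers b y r" "desc_at a z" for z
  proof -
    obtain p q u v where c: "cover y p q u v z" "r \<in> (if b then {p, q} else {u, v})"
      using z by (auto simp: covers_def)
    then have "cover (conj_s a y) (s_Z a p) (s_Z a q) (s_Z a u) (s_Z a v) (conj_s a z)"
      using cover_conj_s[OF y c(1)] z(2) desc by blast
    then have "conj_s a z \<in> covers b (conj_s a y) (s_Z a r)"
      using c(2) by (elim coversI) (auto split: if_splits)
    then show ?thesis
      using asc_at_conj_s[OF covers_FPF[OF y z(1)]] z(2) by simp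
  qed
  then show "?L \<subseteq> ?R" by blast
  have "conj_s a z \<in> covers b y r \<and> desc_at a (conj_s a z)"
    if z: "z \<in> covers b (conj_s a y) (s_Z a r)" "asc_at a z" for z
  proof -
    obtain p q u v where c: "cover (conj_s a y) p q u v z" "s_Z a r \<in> (if b then {p, q} else {u, v})"
      using z by (auto simp: covers_def)
    then have "cover y (s_Z a p) (s_Z a q) (s_Z a u) (s_Z a v) (conj_s a z)"
      using cover_conj_s[OF y'(1) c(1), of a] z(2) y'(2) by auto
    then have "conj_s a z \<in> covers b y (s_Z a (s_Z a r))"
      using c(2) by (elim coversI) (cases b; force)
    then show ?thesis
      using desc_at_conj_s[OF covers_FPF[OF y'(1) z(1)]] z(2) by simp
  qed
  then show "?R \<subseteq> ?L" by (force intro: rev_image_eqI)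
qed

text \<open>In this case \<open>{a, a + 1}\<close> is a cycle of \<open>y\<close>. A move that
  involves it creates no descent at \<open>a\<close>, and any other move leaves it intact.\<close>

lemma covers_stuck:
  assumes y: "y \<in> FPF_Z" and a: "\<not> asc_at a y" "\<not> desc_at a y" and z: "z \<in> covers b y r"
  shows "\<not> desc_at a z"
proof -
  obtain p q u v where c: "up_move y p q u v z"
    using z by (auto simp: covers_def cover_def)
  have ya: "y a = a + 1" "y (a + 1) = a"
    using not_asc_not_desc[OF y a] FPF_Z_invol[OF y, of a] by auto
  show ?thesis
  proof (cases "{a, a + 1} \<subseteq> {p, q, u, v}")
    case True
    then show ?thesis using up_move_adjacent(2)[OF y c] a by blast
  next
    case False
    then have "a \<notin> {p, q, u, v}"
      using ya up_move_values(1-4)[OF y c] by auto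
    then show ?thesis
      using ya up_move_values(10)[OF y c, of a] by (simp add: desc_at_def)
  qed
qed

text \<open>Joining distant cycles creates many inversions: each \<open>k\<close> strictly between
  \<open>q\<close> and \<open>u\<close> gives the inversion \<open>(q, k)\<close> or
  \<open>(k, u)\<close> of \<open>z\<close>. This is what makes the set of covers finite although
  \<open>y\<close> has infinitely many cycles.\<close>

lemma cover_separated_bound:
  assumes y: "y \<in> FPF_Z" and z: "cover y p q u v z" and "q < u"
  shows "u - q \<le> int (card (inv_FPF y)) + 3"
proof -
  have up: "up_move y p q u v z" and card: "card (inv_FPF z) = card (inv_FPF y) + 2"
    using z by (auto simp: cover_def)
  have zF: "z \<in> FPF_Z"
    using up_move_FPF[OF y up] .
  have n: "p < q" "u < v"
    using up by (auto simp: up_move_def)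
  note val = up_move_values(6-9)[OF y up]
  let ?g = "\<lambda>k. if z k < v then (q, k) else (k, u)"
  have "inj_on ?g {q<..<u}"
    by (auto simp: inj_on_def)
  moreover have "?g ` {q<..<u} \<subseteq> inv_FPF z"
  proof
    fix x assume "x \<in> ?g ` {q<..<u}"
    then obtain k where k: "q < k" "k < u" "x = ?g k"
      by auto
    moreover have "z k \<noteq> u" "z k \<noteq> v"
      using k val n assms(3) FPF_Z_eq_iff[OF zF] by (metis less_irrefl order.strict_trans)+
    ultimately show "x \<in> inv_FPF z"
      using val n assms(3) by (auto simp: inv_FPF_def)
  qed
  ultimately have "card {q<..<u} \<le> card (inv_FPF z)"
    using finite_inv_FPF[OF zF] card_inj_on_le by blast
  then show ?thesis
    using card by simp
qed

lemma finite_covers: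
  assumes y: "y \<in> FPF_Z"
  shows "finite (covers b y r)"
proof -
  let ?p = "min r (y r)" and ?q = "max r (y r)" and ?e = "int (card (inv_FPF y)) + 3"
  let ?f = "\<lambda>(i, j). conj_t i j y"
  \<comment> \<open>Candidates for the two points exchanged by \<open>up_move\<close>. The first
    product treats a marked left cycle, separated or crossing; the other two treat a marked right
    cycle, first separated and then crossing.\<close>
  let ?S = "{?q} \<times> ({?q..?q + ?e} \<union> y ` {?p..?q}) \<union> {?p - ?e..?p} \<times> {?p} \<union> {?p..?q} \<times> {?q}"
  have "covers b y r \<subseteq> ?f ` ?S"
  proof
    fix z assume "z \<in> covers b y r"
    then obtain p q u v where c: "cover y p q u v z" "r \<in> (if b then {p, q} else {u, v})"
      by (auto simp: covers_def)
    have up: "up_move y p q u v z"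
      using c by (simp add: cover_def)
    have n: "p < q" "u < v" "p < u" "q < v" "z = conj_t q (if q < u then u else v) y"
      using up by (auto simp: up_move_def)
    have "b \<Longrightarrow> ?p = p \<and> ?q = q" "\<not> b \<Longrightarrow> ?p = u \<and> ?q = v"
      using c(2) n up_move_values(1-4)[OF y up] by auto
    then have "(q, if q < u then u else v) \<in> ?S"
      using n(1-4) cover_separated_bound[OF y c(1)] up_move_values(1-4)[OF y up]
      by (cases b; cases "q < u") (auto simp: image_iff intro!: bexI[of _ u])
    then show "z \<in> ?f ` ?S"
      using n(5) by (metis (no_types, lifting) image_eqI split_conv)
  qed
  then show ?thesis
    by (rule finite_subset) auto
qed

section \<open>Identification of \<open>Psi_plus\<close> and \<open>Psi_minus\<close> with sets of
  covers\<close>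

lemma ell_FPF_Suc_iff: "ell_FPF z = ell_FPF y + 1 \<longleftrightarrow> card (inv_FPF z) = card (inv_FPF y) + 2"
  unfolding ell_FPF_inv by linarith

lemma up_moveI:
  "y p = q \<Longrightarrow> y u = v \<Longrightarrow> p < q \<Longrightarrow> u < v \<Longrightarrow> p < u \<Longrightarrow> q < v \<Longrightarrow>
    up_move y p q u v (conj_t q (if q < u then u else v) y)"
  by (simp add: up_move_def)

text \<open>Passing from separated to nested cycles factors through the crossing matching.\<close>

lemma card_inv_FPF_separated_nested:
  assumes y: "y \<in> FPF_Z" and "y p = q" "y u = v" "p < q" "q < u" "u < v"
  shows "card (inv_FPF y) + 4 \<le> card (inv_FPF (conj_t q v y))"
proof -
  let ?x = "conj_t q u y"
  have x: "up_move y p q u v ?x"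
    using up_moveI[of y p q u v] assms by simp
  note val = up_move_values(6-9)[OF y x]
  have xF: "?x \<in> FPF_Z"
    using y by simp
  have "up_move ?x p u q v (conj_t u v ?x)"
    using up_moveI[of ?x p u q v] assms val by simp
  moreover have "conj_t u v ?x = conj_t q v y"
  proof
    fix k
    have inv: "y q = p" "y v = u"
      using FPF_Z_invol[OF y] assms by auto
    have val: "?x p = u" "?x q = v" "?x u = p" "?x v = q"
      using val assms by simp_all
    show "conj_t u v ?x k = conj_t q v y k"
    proof (cases "k \<in> {p, q, u, v}")
      case True
      have "conj_t u v ?x p = v" "conj_t u v ?x q = u" "conj_t u v ?x u = q" "conj_t u v ?x v = p"
        unfolding conj_t_def[of u v] comp_apply using assms(4-) val by simp_all
      moreover have "conj_t q v y p = v" "conj_t q v y q = u" "conj_t q v y u = q" "conj_t q v y v = p"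
        unfolding conj_t_def comp_apply using assms(2-) inv by simp_all
      ultimately show ?thesis
        using True by (elim insertE) simp_all
    next
      case False
      then have "y k \<notin> {p, q, u, v}"
        using inv assms(2,3) FPF_Z_invol[OF y, of k] by auto
      then show ?thesis
        unfolding conj_t_def[of u v] conj_t_def[of q v] comp_apply
        using up_move_values(10)[OF y x False] False by simp
    qed
  qed
  ultimately show ?thesis
    using card_inv_FPF_up_move[OF y x] card_inv_FPF_up_move[OF xF] by fastforce
qed

text \<open>Read backwards: the conjugation turns nested cycles into crossing ones, and repeating it
  is the move from crossing to nested, which raises the length.\<close>

lemma card_inv_FPF_nested_crossing:
  assumes y: "y \<in> FPF_Z" and "y p = q" "y u = v" "u < p" "p < q" "q < v"
  shows "card (inv_FPF (conj_t q v y)) + 2 \<le> card (inv_FPF y)"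
proof -
  let ?x = "conj_t q v y"
  have xF: "?x \<in> FPF_Z"
    using y by simp
  have "y q = p" "y v = u"
    using FPF_Z_invol[OF y] assms by auto
  then have "?x u = q" "?x p = v"
    using assms by (simp_all add: conj_t_def transp_Z_def)
  then have "up_move ?x u q p v (conj_t q v ?x)"
    using up_moveI[of ?x u q p v] assms by simp
  moreover have "conj_t q v ?x = y"
    by (simp add: conj_t_def fun_eq_iff)
  ultimately show ?thesis
    using card_inv_FPF_up_move[OF xF] by fastforce
qed

text \<open>The partner \<open>k\<close> of \<open>j\<close> has four possible positions. Two give
  the moves of \<open>up_move\<close>. For \<open>q < k < j\<close> the result is nested and the
  length rises too far; for \<open>k < p\<close> nested cycles become crossing and it falls.\<close>

lemma Psi_plus_covers:
  assumes y: "y \<in> FPF_Z" and p: "y p = q" "p < q"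
  shows "Psi_plus y q = covers True y p"
proof
  have q: "y q = p"
    using FPF_Z_invol[OF y] p by auto
  show "Psi_plus y q \<subseteq> covers True y p"
  proof
    fix z assume "z \<in> Psi_plus y q"
    then obtain j where j: "q < j" "z = conj_t q j y" and c: "card (inv_FPF z) = card (inv_FPF y) + 2"
      unfolding Psi_plus_def ell_FPF_Suc_iff by (auto simp: conj_t_def)
    define k where "k = y j"
    have k: "y k = j" "k \<noteq> j" "k \<noteq> p" "k \<noteq> q"
      using FPF_Z_invol[OF y, of j] FPF_Z_neq[OF y, of j] FPF_Z_eq_iff[OF y, of j p]
        FPF_Z_eq_iff[OF y, of j q] q p j by (auto simp: k_def)
    consider "j < k" | "q < k" "k < j" | "p < k" "k < q" | "k < p"
      using k by linarith
    then show "z \<in> covers True y p"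
    proof cases
      case 1
      then have "cover y p q j k z"
        unfolding cover_def using up_moveI[of y p q j k] p j c k_def by simp
      then show ?thesis by (rule coversI) simp
    next
      case 2
      then show ?thesis
        using card_inv_FPF_separated_nested[OF y p(1) k(1)] p j c by simp
    next
      case 3
      then have "cover y p q k j z"
        unfolding cover_def using up_moveI[of y p q k j] p j c k by simp
      then show ?thesis by (rule coversI) simp
    next
      case 4
      then show ?thesis
        using card_inv_FPF_nested_crossing[OF y p(1) k(1)] p j c by simp
    qed
  qed
  show "covers True y p \<subseteq> Psi_plus y q"
  proof
    fix z assume z: "z \<in> covers True y p"
    then obtain p' q' u v where c: "cover y p' q' u v z" "p \<in> {p', q'}"
      by (auto simp: covers_def)
    have up: "up_move y p' q' u v z"
      using c(1) by (simp add: cover_def)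
    have "p' = p" "q' = q"
      using up_move_values(1,2)[OF y up] c(2) p up by (auto simp: up_move_def)
    then have "z = conj_t q (if q < u then u else v) y" "(if q < u then u else v) > q"
      using up by (auto simp: up_move_def)
    then show "z \<in> Psi_plus y q"
      using covers_FPF[OF y z] c(1) unfolding Psi_plus_def ell_FPF_Suc_iff cover_def conj_t_def
      by blast
  qed
qed

lemma Psi_minus_covers:
  assumes y: "y \<in> FPF_Z" and p: "y p = q" "p < q"
  shows "Psi_minus y p = covers False y p"
proof
  have q: "y q = p"
    using FPF_Z_invol[OF y] p by auto
  show "Psi_minus y p \<subseteq> covers False y p"
  proof
    fix z assume "z \<in> Psi_minus y p"
    then obtain i where i: "i < p" "z = conj_t i p y" and c: "card (inv_FPF z) = card (inv_FPF y) + 2"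
      unfolding Psi_minus_def ell_FPF_Suc_iff by (auto simp: conj_t_def)
    define k where "k = y i"
    have k: "y i = k" "y k = i" "k \<noteq> i" "k \<noteq> p" "k \<noteq> q"
      using FPF_Z_invol[OF y, of i] FPF_Z_neq[OF y, of i] FPF_Z_eq_iff[OF y, of i p]
        FPF_Z_eq_iff[OF y, of i q] q p i by (auto simp: k_def)
    \<comment> \<open>Exchanging \<open>i\<close> and \<open>p\<close> amounts to exchanging their
      partners, the form needed in all but the first case below.\<close>
    have z: "z = conj_t k q y"
      using conj_t_swap[OF y, of p i] i p k by auto
    consider "k < i" | "i < k" "k < p" | "p < k" "k < q" | "q < k"
      using k by linarith
    then show "z \<in> covers False y p"
    proof cases
      case 1
      then have "cover y k i p q z"
        unfolding cover_def using up_moveI[of y k i p q] p i c k by simp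
      then show ?thesis by (rule coversI) simp
    next
      case 2
      then show ?thesis
        using card_inv_FPF_separated_nested[OF y k(1) p(1)] p z c by simp
    next
      case 3
      then have "cover y i k p q z"
        unfolding cover_def using up_moveI[of y i k p q] p i c k z by simp
      then show ?thesis by (rule coversI) simp
    next
      case 4
      then show ?thesis
        using card_inv_FPF_nested_crossing[OF y p(1) k(1)] p i c z by (simp add: conj_t_def transp_Z_commute)
    qed
  qed
  show "covers False y p \<subseteq> Psi_minus y p"
  proof
    fix z assume z: "z \<in> covers False y p"
    then obtain p' q' u v where c: "cover y p' q' u v z" "p \<in> {u, v}"
      by (auto simp: covers_def)
    have up: "up_move y p' q' u v z"
      using c(1) by (simp add: cover_def)
    note val = up_move_values(1-5)[OF y up]
    have n: "p' < q'" "u < v" "p' < u" "q' < v"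
      using up by (auto simp: up_move_def)
    have uv: "u = p" "v = q"
      using val c(2) p n by auto
    have "conj_t p' u y = conj_t q' v y"
      using conj_t_swap[OF y, of u p'] val n by auto
    then have "z = conj_t (if q' < u then q' else p') p y" "(if q' < u then q' else p') < p"
      using up n uv by (auto simp: up_move_def)
    then show "z \<in> Psi_minus y p"
      using covers_FPF[OF y z] c(1) unfolding Psi_minus_def ell_FPF_Suc_iff cover_def conj_t_def
      by blast
  qed
qed

section \<open>The Leibniz rule\<close>

text \<open>Formal sums of involutions are handled dually, through integer functions on involutions:
  \<open>peel a f\<close> evaluates \<open>f\<close> on the result of the length-lowering operator
  at \<open>a\<close>.\<close>

definition peel :: "int \<Rightarrow> ((int \<Rightarrow> int) \<Rightarrow> int) \<Rightarrow> (int \<Rightarrow> int) \<Rightarrow> int" where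
  "peel a f y = (if desc_at a y then f (conj_s a y) else 0)"

lemma inj_conj_s: "inj_on (conj_s a) S"
  by (rule inj_on_inverseI[where g = "conj_s a"]) simp

text \<open>At a descent, the covers with a descent correspond to the covers of
  \<open>conj_s a y\<close> that keep the ascent; the only one that may fail to is \<open>y\<close>,
  whence the subtraction. At an ascent, only the cover \<open>conj_s a y\<close> can contribute, and
  it gives \<open>f y\<close>. If \<open>a\<close> and \<open>a + 1\<close> are matched, nothing
  contributes.\<close>

lemma sum_covers_peel:
  assumes y: "y \<in> FPF_Z"
  shows "(\<Sum>z\<in>covers b y r. peel a f z) =
    (if desc_at a y then (\<Sum>z\<in>covers b (conj_s a y) (s_Z a r). f z) -
         (if (if b then a + 1 else a) \<in> {r, y r} then f y else 0)
     else if asc_at a y \<and> (if b then a else a + 1) \<in> {r, y r} then f y else 0)"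
proof -
  let ?S = "covers b y r" and ?D = "{z \<in> covers b y r. desc_at a z}"
  have "(\<Sum>z\<in>?S. peel a f z) = (\<Sum>z\<in>?D. f (conj_s a z))"
    unfolding peel_def by (rule sum.inter_filter[symmetric]) (rule finite_covers[OF y])
  also have "\<dots> = sum f (conj_s a ` ?D)"
    by (simp add: sum.reindex inj_conj_s)
  finally have sum: "(\<Sum>z\<in>?S. peel a f z) = sum f (conj_s a ` ?D)" .
  consider "desc_at a y" | "asc_at a y" | "\<not> desc_at a y" "\<not> asc_at a y"
    by blast
  then show ?thesis
  proof cases
    case 1
    let ?y = "conj_s a y" and ?S' = "covers b (conj_s a y) (s_Z a r)"
    have y': "?y \<in> FPF_Z" "asc_at a ?y"
      using y 1 by (simp_all add: asc_at_conj_s)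
    have "sum f ?S' = sum f ({z \<in> ?S'. asc_at a z} \<union> {z \<in> ?S'. \<not> asc_at a z})"
      by (rule sum.cong) auto
    also have "\<dots> = sum f {z \<in> ?S'. asc_at a z} + sum f {z \<in> ?S'. \<not> asc_at a z}"
      using finite_covers[OF y'(1)] by (intro sum.union_disjoint) auto
    also have "{z \<in> ?S'. \<not> asc_at a z} =
      (if (if b then a else a + 1) \<in> {s_Z a r, ?y (s_Z a r)} then {y} else {})"
      using covers_not_asc[OF y', of b "s_Z a r"] by simp
    also have "(if b then a else a + 1) \<in> {s_Z a r, ?y (s_Z a r)} \<longleftrightarrow>
      (if b then a + 1 else a) \<in> {r, y r}"
      by (auto simp: conj_s_apply s_Z_def transp_Z_def)
    finally show ?thesis
      unfolding sum covers_conj_s[OF y 1] using 1 by simp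
  next
    case 2
    \<comment> \<open>A cover that loses the ascent is \<open>conj_s a y\<close>, so it has a
      descent there rather than a cycle \<open>{a, a + 1}\<close>.\<close>
    have "?D = {z \<in> ?S. \<not> asc_at a z}"
    proof -
      have "desc_at a z" if "z \<in> ?S" "\<not> asc_at a z" for z
      proof -
        have "z \<in> {z \<in> ?S. \<not> asc_at a z}"
          using that by simp
        then have "z = conj_s a y"
          unfolding covers_not_asc[OF y 2] by (simp split: if_splits)
        then show ?thesis
          using 2 desc_at_conj_s[OF y] by simp
      qed
      then show ?thesis
        using asc_not_desc by blast
    qed
    then have "?D = (if (if b then a else a + 1) \<in> {r, y r} then {conj_s a y} else {})"
      using covers_not_asc[OF y 2, of b r] by simp
    then show ?thesis
      unfolding sum using 2 asc_not_desc[OF 2] by simp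
  next
    case 3
    then have D: "?D = {}"
      using covers_stuck[OF y] by blast
    show ?thesis
      unfolding sum D using 3 by simp
  qed
qed

text \<open>Dual form of \<open>D\<^sub>c y\<close> for the cycle \<open>c = {r, y r}\<close>,
  evaluated on \<open>f\<close>.\<close>

definition transition :: "((int \<Rightarrow> int) \<Rightarrow> int) \<Rightarrow> (int \<Rightarrow> int) \<Rightarrow> int \<Rightarrow> int" where
  "transition f y r = (\<Sum>z\<in>covers True y r. f z) - (\<Sum>z\<in>covers False y r. f z)"

text \<open>
  This mirrors the Leibniz rule of the divided difference operator \<open>a\<close> applied to the product of
  \<open>x\<^sub>r + x\<^bsub>y r\<^esub>\<close> with a Schubert polynomial.
\<close>

lemma transition_peel:
  assumes y: "y \<in> FPF_Z"
  shows "transition (peel a f) y r =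
    (if desc_at a y then transition f (conj_s a y) (s_Z a r) else 0) +
    (of_bool (a \<in> {r, y r}) - of_bool (a + 1 \<in> {r, y r})) * f y"
proof -
  \<comment> \<open>When \<open>a\<close> and \<open>a + 1\<close> are matched, the marked cycle
    contains both or neither, so the correction term vanishes.\<close>
  have "a \<in> {r, y r} \<longleftrightarrow> a + 1 \<in> {r, y r}" if "\<not> desc_at a y" "\<not> asc_at a y"
  proof -
    have "y a = a + 1" "y (a + 1) = a"
      using not_asc_not_desc(1)[OF y that(2,1)] FPF_Z_invol[OF y, of a] by simp_all
    then have "y r = a \<longleftrightarrow> r = a + 1" "y r = a + 1 \<longleftrightarrow> r = a"
      using FPF_Z_eq_iff[OF y, of r "a + 1"] FPF_Z_eq_iff[OF y, of r a] by simp_all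
    then show ?thesis
      unfolding insert_iff empty_iff by metis
  qed
  moreover have "desc_at a y \<Longrightarrow> \<not> asc_at a y"
    using asc_not_desc by blast
  ultimately show ?thesis
    unfolding transition_def sum_covers_peel[OF y] if_True if_False
    by (cases "a \<in> {r, y r}"; cases "a + 1 \<in> {r, y r}"; cases "desc_at a y"; cases "asc_at a y")
      (simp_all only: simp_thms if_True if_False of_bool_eq, simp_all)
qed

lemma transition_add: "transition (\<lambda>z. f z + g z) y r = transition f y r + transition g y r"
  by (simp add: transition_def sum.distrib)

lemma transition_zero: "transition (\<lambda>z. 0) y r = 0"
  by (simp add: transition_def)

section \<open>Commuting the transition with the product of the letter operators\<close>

definition lower :: "nat \<Rightarrow> ((nat \<Rightarrow> nat) \<Rightarrow> (int \<Rightarrow> int) \<Rightarrow> int) \<Rightarrow> (nat \<Rightarrow> nat) \<Rightarrow> (int \<Rightarrow> int) \<Rightarrow> int" where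
  "lower k f \<alpha> y = (if 0 < \<alpha> k then f (\<alpha>(k := \<alpha> k - 1)) y else 0)"

text \<open>The operator \<open>1 + x\<^sub>k \<partial>\<^sub>a\<close> on coefficient functions,
  with \<open>lower k\<close> as multiplication by \<open>x\<^sub>k\<close>.\<close>

definition add_letter :: "nat \<Rightarrow> int \<Rightarrow> ((nat \<Rightarrow> nat) \<Rightarrow> (int \<Rightarrow> int) \<Rightarrow> int) \<Rightarrow>
    (nat \<Rightarrow> nat) \<Rightarrow> (int \<Rightarrow> int) \<Rightarrow> int" where
  "add_letter k a f \<alpha> y = f \<alpha> y + peel a (lower k f \<alpha>) y"

lemma fpf_on_desc:
  assumes "fpf_on n y" "desc_at a y"
  shows "a \<in> window n" "a + 1 \<in> window n" "fpf_on n (conj_s a y)"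
proof -
  have "(a, a + 1) \<in> inv_FPF y"
    using assms(2) by (simp add: inv_FPF_def desc_at_def)
  then show "a \<in> window n" "a + 1 \<in> window n"
    using inv_FPF_window[OF assms(1)] by auto
  then show "fpf_on n (conj_s a y)"
    unfolding conj_s_eq_conj_t by (rule fpf_on_conj_t[OF assms(1)])
qed

text \<open>The correction at \<open>a + 1\<close> carried by \<open>f\<close> cancels the negative
  term of the Leibniz rule. The positive term at \<open>a\<close> combines with the conjugated
  correction into \<open>x\<^sub>k (f + x\<^sub>k \<partial>\<^sub>a f)\<close>.\<close>

lemma transition_add_letter:
  assumes f: "\<And>\<alpha> y r. y \<in> FPF_Z \<Longrightarrow> fpf_on n y \<Longrightarrow> r \<in> window n \<Longrightarrow>
      transition (f \<alpha>) y r = of_bool (a + 1 \<in> {r, y r}) * lower k f \<alpha> y"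
    and y: "y \<in> FPF_Z" "fpf_on n y" "r \<in> window n"
  shows "transition (add_letter k a f \<alpha>) y r = of_bool (a \<in> {r, y r}) * lower k (add_letter k a f) \<alpha> y"
proof -
  let ?c = "{r, y r}"
  have "transition (lower k f \<alpha>) (conj_s a y) (s_Z a r) =
      of_bool (a \<in> ?c) * lower k (lower k f) \<alpha> (conj_s a y)" if "desc_at a y"
  proof -
    note win = fpf_on_desc[OF y(2) that]
    have "s_Z a r \<in> window n"
      unfolding s_Z_def using transp_Z_window[OF win(1,2)] y(3) by simp
    \<comment> \<open>Conjugation moves the marked cycle by \<open>s_Z a\<close>, so the correction
      at \<open>a + 1\<close> after conjugation is one at \<open>a\<close> before it.\<close>
    moreover have "a + 1 \<in> {s_Z a r, conj_s a y (s_Z a r)} \<longleftrightarrow> a \<in> ?c"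
      by (auto simp: conj_s_apply s_Z_def transp_Z_def)
    ultimately have "transition (f \<beta>) (conj_s a y) (s_Z a r) = of_bool (a \<in> ?c) * lower k f \<beta> (conj_s a y)" for \<beta>
      using f[OF FPF_Z_conj_s[OF y(1)] win(3)] by (simp only: simp_thms)
    moreover have "lower k f \<alpha> = (if 0 < \<alpha> k then f (\<alpha>(k := \<alpha> k - 1)) else (\<lambda>z. 0))"
      by (simp add: lower_def fun_eq_iff)
    ultimately show ?thesis
      by (cases "0 < \<alpha> k") (simp_all add: transition_zero lower_def[of k "lower k f"])
  qed
  then have "transition (peel a (lower k f \<alpha>)) y r =
      of_bool (a \<in> ?c) * peel a (lower k (lower k f) \<alpha>) y +
      (of_bool (a \<in> ?c) - of_bool (a + 1 \<in> ?c)) * lower k f \<alpha> y"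
    unfolding transition_peel[OF y(1)] by (simp add: peel_def)
  moreover have "lower k (add_letter k a f) \<alpha> y = lower k f \<alpha> y + peel a (lower k (lower k f) \<alpha>) y"
    by (simp add: lower_def add_letter_def peel_def)
  moreover have "add_letter k a f \<alpha> = (\<lambda>z. f \<alpha> z + peel a (lower k f \<alpha>) z)"
    by (simp add: add_letter_def fun_eq_iff)
  ultimately show ?thesis
    by (simp only: transition_add f[OF y] algebra_simps)
qed

text \<open>The head of the list acts first on \<open>y\<close> and so supplies the last letter of a
  word; the base case reads off the coefficient of \<open>Theta\<close> at the constant
  monomial.\<close>

fun word_count :: "(nat \<times> int) list \<Rightarrow> (nat \<Rightarrow> nat) \<Rightarrow> (int \<Rightarrow> int) \<Rightarrow> int" where
  "word_count [] \<alpha> y = of_bool (y = Theta \<and> \<alpha> = (\<lambda>_. 0))"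
| "word_count ((k, a) # L) \<alpha> y = add_letter k a (word_count L) \<alpha> y"

text \<open>The letters start at \<open>- 2n\<close>, one below the window, so that the correction
  left at the end of a block falls outside every marked cycle.\<close>

fun letters :: "nat \<Rightarrow> nat \<Rightarrow> (nat \<times> int) list" where
  "letters n 0 = []"
| "letters n (Suc m) = map (Pair (Suc m)) [- 2 * int n..2 * int n] @ letters n m"

lemma inv_FPF_Theta: "inv_FPF Theta = {}"
  using Theta_inversion by (auto simp: inv_FPF_def)

lemma covers_not_Theta: "z \<in> covers b y r \<Longrightarrow> z \<noteq> Theta"
  by (auto simp: covers_def cover_def inv_FPF_Theta)

text \<open>The block for one \<open>k\<close> is built from its last letter \<open>2n\<close>
  downwards. The induction starts with the correction at \<open>2n + 1\<close>, which vanishes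
  because the cycle lies in the window.\<close>

lemma transition_block:
  assumes L: "\<And>\<alpha> y r. y \<in> FPF_Z \<Longrightarrow> fpf_on n y \<Longrightarrow> r \<in> window n \<Longrightarrow>
      transition (word_count L \<alpha>) y r = 0"
    and "y \<in> FPF_Z" "fpf_on n y" "r \<in> window n"
  shows "transition (word_count (map (Pair k) [2 * int n + 1 - int d..2 * int n] @ L) \<alpha>) y r =
    of_bool (2 * int n + 1 - int d \<in> {r, y r}) *
      lower k (word_count (map (Pair k) [2 * int n + 1 - int d..2 * int n] @ L)) \<alpha> y"
  using assms(2-)
proof (induction d arbitrary: \<alpha> y r)
  case 0
  then have "r \<in> window n" "y r \<in> window n"
    using fpf_on_window by auto
  then have "2 * int n + 1 \<notin> {r, y r}"
    by (auto simp: window_def)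
  then show ?case
    using L[OF 0] by simp
next
  case (Suc d)
  let ?a = "2 * int n + 1 - int (Suc d)" and ?M = "map (Pair k) [2 * int n + 1 - int d..2 * int n] @ L"
  have "[?a..2 * int n] = ?a # [2 * int n + 1 - int d..2 * int n]"
    using upto_rec1[of ?a "2 * int n"] by (simp add: algebra_simps)
  then have *: "word_count (map (Pair k) [?a..2 * int n] @ L) = add_letter k ?a (word_count ?M)"
    by (simp add: fun_eq_iff)
  have a: "?a + 1 = 2 * int n + 1 - int d"
    by simp
  show ?case
    unfolding * by (rule transition_add_letter[OF _ Suc.prems]) (unfold a, rule Suc.IH)
qed

lemma transition_letters:
  assumes "y \<in> FPF_Z" "fpf_on n y" "r \<in> window n"
  shows "transition (word_count (letters n m) \<alpha>) y r = 0"
  using assms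
proof (induction m arbitrary: \<alpha> y r)
  case 0
  have "(\<Sum>z\<in>covers b y r. word_count [] \<alpha> z) = 0" for b
    using covers_not_Theta by (intro sum.neutral) fastforce
  then show ?case
    by (simp add: transition_def)
next
  case (Suc m)
  \<comment> \<open>The number of letters from \<open>- 2n\<close> to \<open>2n\<close>, so that
    \<open>transition_block\<close> covers the whole block.\<close>
  let ?d = "4 * n + 1"
  have d: "- 2 * int n = 2 * int n + 1 - int ?d"
    by simp
  have "- 2 * int n \<notin> {r, y r}"
    using Suc.prems(3) fpf_on_window[OF Suc.prems(2), of r] by (auto simp: window_def)
  then have *: "of_bool (2 * int n + 1 - int ?d \<in> {r, y r}) = (0 :: int)"
    unfolding d by simp
  show ?case
    unfolding letters.simps d
    by (rule trans[OF transition_block[OF Suc.IH Suc.prems]]) (simp_all only: * mult_zero_left)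
qed

section \<open>Reduced words of atoms\<close>

lemma len_Z_inversions: "len_Z w = card (inversions_on UNIV w)"
  by (simp add: len_Z_def inversions_on_def)

lemma finite_inversions_perm_Z:
  assumes "perm_Z w"
  shows "finite (inversions_on UNIV w)"
proof -
  obtain n where n: "\<And>i. i \<notin> window n \<Longrightarrow> w i = i" "\<And>i. w i \<in> window n \<longleftrightarrow> i \<in> window n"
    using perm_Z_window[OF assms] by blast
  have "inversions_on UNIV w \<subseteq> window n \<times> window n"
  proof (clarsimp simp: inversions_on_def)
    fix i j assume ij: "i < j" "w j < w i"
    have "i \<in> window n \<or> j \<in> window n"
      using ij n(1)[of i] n(1)[of j] by linarith
    moreover have False if "i \<in> window n" "j \<notin> window n"
      using that n(1)[OF that(2)] n(2)[of i] ij by (simp add: window_def)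
    moreover have False if "j \<in> window n" "i \<notin> window n"
      using that n(1)[OF that(2)] n(2)[of j] ij by (simp add: window_def)
    ultimately show "i \<in> window n \<and> j \<in> window n"
      by blast
  qed
  then show ?thesis
    by (rule finite_subset) simp
qed

lemma perm_Z_s: "perm_Z (s_Z a)"
  by (simp add: s_Z_def perm_Z_transp)

lemma len_Z_asc:
  assumes "perm_Z w" "w a < w (a + 1)"
  shows "len_Z (w \<circ> s_Z a) = Suc (len_Z w)"
  unfolding len_Z_inversions
  by (intro card_inversions_simple finite_inversions_perm_Z assms UNIV_I)

lemma comp_s_Z_s_Z: "w \<circ> s_Z a \<circ> s_Z a = w"
  by (rule ext) (simp only: comp_apply s_Z_simps)

lemma len_Z_desc:
  assumes "perm_Z w" "w (a + 1) < w a"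
  shows "len_Z w = Suc (len_Z (w \<circ> s_Z a))"
proof -
  have "(w \<circ> s_Z a) a < (w \<circ> s_Z a) (a + 1)"
    using assms(2) by simp
  from len_Z_asc[OF perm_Z_comp[OF assms(1) perm_Z_s] this] show ?thesis
    unfolding comp_s_Z_s_Z .
qed

lemma len_Z_comp_s_le:
  assumes "perm_Z w"
  shows "len_Z (w \<circ> s_Z a) \<le> Suc (len_Z w)"
proof -
  have "w a \<noteq> w (a + 1)"
    using perm_Z_inv(1)[OF assms, of a] perm_Z_inv(1)[OF assms, of "a + 1"] by auto
  then show ?thesis
    using len_Z_asc[OF assms, of a] len_Z_desc[OF assms, of a] by linarith
qed

text \<open>The displacement \<open>w i - i\<close> never decreases with \<open>i\<close>, and it
  vanishes far out on both sides.\<close>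

lemma perm_Z_increasing:
  assumes w: "perm_Z w" and inc: "\<And>a. w a < w (a + 1)"
  shows "w = id"
proof
  fix i
  obtain n where n: "\<And>i. i \<notin> window n \<Longrightarrow> w i = i" "\<And>i. w i \<in> window n \<longleftrightarrow> i \<in> window n"
    using perm_Z_window[OF w] by blast
  have mono: "w i - i \<le> w (i + int d) - (i + int d)" for i d
  proof (induction d)
    case (Suc d)
    then show ?case using inc[of "i + int d"] by (simp add: algebra_simps)
  qed simp
  define d where "d = nat \<bar>i\<bar> + 2 * n + 1"
  have "i + int d \<notin> window n" "i - int d \<notin> window n"
    by (simp_all add: window_def d_def)
  then have "w (i + int d) = i + int d" "w (i - int d) = i - int d"
    using n(1) by simp_all
  then show "w i = id i"
    using mono[of i d] mono[of "i - int d" d] by simp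
qed

lemma word_prod_Nil: "word_prod [] = id"
  by (simp add: word_prod_def)

lemma word_prod_snoc: "word_prod (a @ [b]) = word_prod a \<circ> s_Z b"
proof -
  have "foldr (\<lambda>k f. s_Z k \<circ> f) a g = foldr (\<lambda>k f. s_Z k \<circ> f) a id \<circ> g" for g
    by (induction a) (auto simp: comp_assoc)
  from this[of "s_Z b"] show ?thesis
    by (simp add: word_prod_def)
qed

lemma perm_Z_word_prod: "perm_Z (word_prod a)"
proof (induction a rule: rev_induct)
  case Nil
  show ?case
    unfolding word_prod_Nil perm_Z_def by simp
next
  case (snoc b a)
  show ?case
    unfolding word_prod_snoc by (rule perm_Z_comp[OF snoc perm_Z_s])
qed

lemma len_Z_id: "len_Z id = 0"
proof -
  have "{(i, j). i < j \<and> id i > id j} = ({} :: (int \<times> int) set)"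
    by auto
  then show ?thesis
    unfolding len_Z_def by (metis card.empty)
qed

lemma len_Z_word_prod: "len_Z (word_prod a) \<le> length a"
proof (induction a rule: rev_induct)
  case (snoc b a)
  have "len_Z (word_prod (a @ [b])) \<le> Suc (len_Z (word_prod a))"
    unfolding word_prod_snoc by (rule len_Z_comp_s_le[OF perm_Z_word_prod])
  then show ?case
    using snoc by simp
qed (simp only: word_prod_Nil len_Z_id)

lemma reduced_word_exists:
  assumes "perm_Z w"
  shows "\<exists>a. reduced_word w a"
  using assms
proof (induction "len_Z w" arbitrary: w rule: less_induct)
  case less
  show ?case
  proof (cases "w = id")
    case True
    then have "reduced_word w []"
      by (simp add: reduced_word_def len_Z_id word_prod_Nil)
    then show ?thesis ..
  next
    case False
    then obtain b where "\<not> w b < w (b + 1)"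
      using perm_Z_increasing[OF less.prems] by blast
    moreover have "w b \<noteq> w (b + 1)"
      using perm_Z_inv(1)[OF less.prems, of b] perm_Z_inv(1)[OF less.prems, of "b + 1"] by auto
    ultimately have len: "len_Z w = Suc (len_Z (w \<circ> s_Z b))"
      using len_Z_desc[OF less.prems, of b] by linarith
    then obtain a where "reduced_word (w \<circ> s_Z b) a"
      using less.hyps[OF _ perm_Z_comp[OF less.prems perm_Z_s]] by fastforce
    then have a: "word_prod a = w \<circ> s_Z b" "length a = len_Z (w \<circ> s_Z b)"
      by (auto simp only: reduced_word_def)
    have "reduced_word w (a @ [b])"
      unfolding reduced_word_def word_prod_snoc a(1) comp_s_Z_s_Z len using a(2) by simp
    then show ?thesis ..
  qed
qed

section \<open>Words acting on \<open>Theta\<close>, and the reduced words of atoms\<close>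

definition conj_word :: "int list \<Rightarrow> int \<Rightarrow> int" where
  "conj_word a = foldl (\<lambda>y b. conj_s b y) Theta a"

lemma conj_word_Nil [simp]: "conj_word [] = Theta"
  and conj_word_snoc [simp]: "conj_word (a @ [b]) = conj_s b (conj_word a)"
  by (simp_all add: conj_word_def)

lemma conj_word_eq: "inv (word_prod a) \<circ> Theta \<circ> word_prod a = conj_word a"
proof (induction a rule: rev_induct)
  case (snoc b a)
  have "inv (word_prod a \<circ> s_Z b) = s_Z b \<circ> inv (word_prod a)"
    by (rule inv_unique_comp) (auto simp: fun_eq_iff perm_Z_inv[OF perm_Z_word_prod])
  then show ?case
    unfolding word_prod_snoc conj_word_snoc conj_s_def snoc.IH[symmetric] by (simp only: comp_assoc)
qed (simp add: word_prod_Nil)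

lemma conj_word_FPF: "conj_word a \<in> FPF_Z"
  by (induction a rule: rev_induct) (auto simp: Theta_FPF)

lemma card_inv_FPF_conj_s_le:
  assumes "y \<in> FPF_Z"
  shows "card (inv_FPF (conj_s a y)) \<le> card (inv_FPF y) + 2"
proof -
  consider "asc_at a y" | "desc_at a y" | "conj_s a y = y"
    using not_asc_not_desc(2)[OF assms] by blast
  then show ?thesis
  proof cases
    case 1
    then show ?thesis using card_inv_FPF_asc[OF assms 1] by linarith
  next
    case 2
    then show ?thesis using card_inv_FPF_desc[OF assms 2] by linarith
  qed simp
qed

lemma card_inv_FPF_conj_word: "card (inv_FPF (conj_word a)) \<le> 2 * length a"
proof (induction a rule: rev_induct)
  case (snoc b a)
  then show ?case
    using card_inv_FPF_conj_s_le[OF conj_word_FPF, of b a] by simp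
qed (simp add: inv_FPF_Theta)

text \<open>Let \<open>p\<close> be the least point where \<open>y\<close> differs from
  \<open>Theta\<close>; its partner \<open>m\<close> exceeds \<open>p + 1\<close>. Without descents
  the values at \<open>p, ..., m - 1\<close> are all at least \<open>m\<close>. As
  \<open>y m = p\<close>, the step from \<open>m - 1\<close> to \<open>m\<close> is then neither an
  ascent nor a cycle.\<close>

lemma exists_desc_at:
  assumes y: "y \<in> FPF_Z" and "y \<noteq> Theta"
  shows "\<exists>a. desc_at a y"
proof (rule ccontr)
  assume "\<nexists>a. desc_at a y"
  then have asc: "y a < y (a + 1) \<or> y a = a + 1" for a
    using not_asc_not_desc(1)[OF y, of a] by (auto simp: asc_at_def)
  obtain n where n: "fpf_on n y"
    using FPF_Z_fpf_on[OF y] .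
  let ?S = "{i. y i \<noteq> Theta i}"
  have "?S \<subseteq> window n"
    using n by (auto simp: fpf_on_def)
  then have fin: "finite ?S"
    by (rule finite_subset) simp
  have ne: "?S \<noteq> {}"
    using assms(2) by (auto simp: fun_eq_iff)
  define p where "p = Min ?S"
  have p: "y p \<noteq> Theta p" "\<And>i. i < p \<Longrightarrow> y i = Theta i"
    using Min_in[OF fin ne] Min_le[OF fin] unfolding p_def by (auto, force)
  define m where "m = y p"
  have ym: "y m = p"
    using FPF_Z_invol[OF y] by (simp add: m_def)
  have mp: "m \<noteq> p"
    using FPF_Z_neq[OF y] by (simp add: m_def)
  have "\<not> m < p"
  proof
    assume "m < p"
    then have "Theta p = m" using p(2)[of m] ym by (metis Theta_Theta)
    then show False using p(1) by (simp add: m_def)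
  qed
  moreover have "odd p"
  proof (rule ccontr)
    assume "\<not> odd p"
    then have "Theta p = p - 1" "Theta (p - 1) = p"
      by (simp_all add: Theta_def)
    then have "y (p - 1) = p"
      using p(2)[of "p - 1"] by simp
    then show False
      using p(1) \<open>Theta p = p - 1\<close> FPF_Z_invol[OF y, of "p - 1"] by simp
  qed
  then have "m \<noteq> p + 1"
    using p(1) by (simp add: Theta_def m_def)
  ultimately have pm: "p + 1 < m"
    using mp by simp
  have ge: "m \<le> y (p + int d)" if "p + int d < m" for d
    using that
  proof (induction d)
    case (Suc d)
    let ?i = "p + int d"
    have IH: "m \<le> y ?i"
      using Suc by simp
    have "y ?i \<noteq> ?i + 1"
      using IH Suc.prems by simp
    then show ?case
      using asc[of ?i] IH by (simp add: algebra_simps)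
  qed (simp add: m_def)
  have "m \<le> y (m - 1)"
    using ge[of "nat (m - 1 - p)"] pm by simp
  then have "y (m - 1) = m"
    using asc[of "m - 1"] ym pm by simp
  then show False
    using FPF_Z_invol[OF y, of "m - 1"] ym pm by simp
qed

text \<open>The words in which each letter raises the FPF length by one;
  \<open>reduced_words_A_FPF\<close> shows that they are the reduced words of all atoms of
  \<open>z\<close>.\<close>

definition fpf_words :: "(int \<Rightarrow> int) \<Rightarrow> int list set" where
  "fpf_words z = {a. conj_word a = z \<and> 2 * length a = card (inv_FPF z)}"

lemma fpf_words_Nil: "y \<in> FPF_Z \<Longrightarrow> [] \<in> fpf_words y \<longleftrightarrow> y = Theta"
  by (auto simp: fpf_words_def inv_FPF_Theta)

text \<open>A letter raises \<open>card (inv_FPF _)\<close> by at most 2, so a word of this length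
  has no slack: its last letter must be a descent of \<open>y\<close>.\<close>

lemma fpf_words_snoc:
  assumes y: "y \<in> FPF_Z"
  shows "a @ [b] \<in> fpf_words y \<longleftrightarrow> desc_at b y \<and> a \<in> fpf_words (conj_s b y)"
proof
  assume "a @ [b] \<in> fpf_words y"
  then have *: "conj_s b (conj_word a) = y" "2 * length a + 2 = card (inv_FPF y)"
    by (auto simp: fpf_words_def)
  then have a: "conj_word a = conj_s b y"
    by auto
  have "card (inv_FPF (conj_s b y)) + 2 \<le> card (inv_FPF y)"
    using card_inv_FPF_conj_word[of a] * unfolding a by simp
  then have "desc_at b y"
    using card_inv_FPF_asc[OF y, of b] not_asc_not_desc(2)[OF y, of b]
    by (metis add_le_same_cancel1 le_add1 le_trans not_numeral_le_zero)
  then show "desc_at b y \<and> a \<in> fpf_words (conj_s b y)"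
    using a * card_inv_FPF_desc[OF y] by (simp add: fpf_words_def)
next
  assume "desc_at b y \<and> a \<in> fpf_words (conj_s b y)"
  then show "a @ [b] \<in> fpf_words y"
    using card_inv_FPF_desc[OF y, of b] by (simp add: fpf_words_def)
qed

lemma fpf_words_nonempty:
  assumes "y \<in> FPF_Z"
  shows "\<exists>a. a \<in> fpf_words y"
  using assms
proof (induction "card (inv_FPF y)" arbitrary: y rule: less_induct)
  case less
  show ?case
  proof (cases "y = Theta")
    case True
    then show ?thesis
      using fpf_words_Nil[OF less.prems] by blast
  next
    case False
    then obtain b where b: "desc_at b y"
      using exists_desc_at[OF less.prems] by blast
    then obtain a where "a \<in> fpf_words (conj_s b y)"
      using less.hyps[of "conj_s b y"] card_inv_FPF_desc[OF less.prems b] less.prems by auto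
    then show ?thesis
      using fpf_words_snoc[OF less.prems] b by blast
  qed
qed

lemma card_inv_FPF_le_len_Z:
  assumes "perm_Z w" "inv w \<circ> Theta \<circ> w = z"
  shows "card (inv_FPF z) \<le> 2 * len_Z w"
proof -
  obtain a where a: "reduced_word w a"
    using reduced_word_exists[OF assms(1)] ..
  then have "z = conj_word a"
    using conj_word_eq[of a] assms(2) by (simp add: reduced_word_def)
  then show ?thesis
    using card_inv_FPF_conj_word[of a] a by (simp add: reduced_word_def)
qed

lemma fpf_words_len:
  assumes "a \<in> fpf_words z"
  shows "2 * len_Z (word_prod a) = card (inv_FPF z)" "length a = len_Z (word_prod a)"
proof -
  have a: "conj_word a = z" "2 * length a = card (inv_FPF z)"
    using assms by (auto simp: fpf_words_def)
  have "card (inv_FPF z) \<le> 2 * len_Z (word_prod a)"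
    using card_inv_FPF_le_len_Z[OF perm_Z_word_prod, of a z] conj_word_eq[of a] a by simp
  then show "2 * len_Z (word_prod a) = card (inv_FPF z)" "length a = len_Z (word_prod a)"
    using len_Z_word_prod[of a] a by auto
qed

text \<open>The lower bound \<open>card_inv_FPF_le_len_Z\<close> is attained by the product of any
  word in \<open>fpf_words z\<close>, so minimality becomes an equation for the length.\<close>

lemma A_FPF_eq:
  assumes "z \<in> FPF_Z"
  shows "A_FPF z = {w. perm_Z w \<and> inv w \<circ> Theta \<circ> w = z \<and> 2 * len_Z w = card (inv_FPF z)}"
proof -
  obtain a where a: "a \<in> fpf_words z"
    using fpf_words_nonempty[OF assms] ..
  then have w: "inv (word_prod a) \<circ> Theta \<circ> word_prod a = z"
    using conj_word_eq[of a] by (simp add: fpf_words_def)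
  show ?thesis
  proof (intro set_eqI iffI)
    fix w assume "w \<in> A_FPF z"
    then have *: "perm_Z w" "inv w \<circ> Theta \<circ> w = z" "len_Z w \<le> len_Z (word_prod a)"
      using w perm_Z_word_prod[of a] unfolding A_FPF_def by auto
    then show "w \<in> {w. perm_Z w \<and> inv w \<circ> Theta \<circ> w = z \<and> 2 * len_Z w = card (inv_FPF z)}"
      using card_inv_FPF_le_len_Z[OF *(1,2)] fpf_words_len(1)[OF a] by simp
  next
    fix w assume "w \<in> {w. perm_Z w \<and> inv w \<circ> Theta \<circ> w = z \<and> 2 * len_Z w = card (inv_FPF z)}"
    then show "w \<in> A_FPF z"
      unfolding A_FPF_def using card_inv_FPF_le_len_Z by fastforce
  qed
qed

text \<open>Merges the sum over atoms and the sums over their reduced words into a single sum over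
  \<open>fpf_words z\<close>.\<close>

lemma reduced_words_A_FPF:
  assumes "z \<in> FPF_Z"
  shows "w \<in> A_FPF z \<and> reduced_word w a \<longleftrightarrow> a \<in> fpf_words z \<and> w = word_prod a"
proof
  assume "w \<in> A_FPF z \<and> reduced_word w a"
  then show "a \<in> fpf_words z \<and> w = word_prod a"
    unfolding A_FPF_eq[OF assms] reduced_word_def fpf_words_def
    using conj_word_eq[of a] by auto
next
  assume a: "a \<in> fpf_words z \<and> w = word_prod a"
  then have "inv w \<circ> Theta \<circ> w = z"
    using conj_word_eq[of a] by (auto simp: fpf_words_def)
  then show "w \<in> A_FPF z \<and> reduced_word w a"
    unfolding A_FPF_eq[OF assms] reduced_word_def
    using a fpf_words_len[of a z] perm_Z_word_prod[of a] by auto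
qed

lemma fpf_words_letters:
  assumes "y \<in> FPF_Z" "fpf_on n y" "a \<in> fpf_words y"
  shows "set a \<subseteq> window n"
  using assms
proof (induction a arbitrary: y rule: rev_induct)
  case (snoc b a)
  then have "desc_at b y" "a \<in> fpf_words (conj_s b y)"
    using fpf_words_snoc by auto
  then show ?case
    using snoc.IH[of "conj_s b y"] snoc.prems fpf_on_desc[of n y b] by auto
qed simp

text \<open>After a descent at \<open>b\<close> is removed, \<open>b\<close> is an ascent and cannot
  be removed again. This reconciles \<open>compatible\<close>, which lets equal neighbouring letters
  share an index, with the strict order \<open>before\<close>.\<close>

lemma fpf_words_distinct_adj:
  assumes "y \<in> FPF_Z" "a \<in> fpf_words y"
  shows "distinct_adj a"
  using assms
proof (induction a arbitrary: y rule: rev_induct)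
  case (snoc b a)
  then have b: "desc_at b y" "a \<in> fpf_words (conj_s b y)"
    using fpf_words_snoc by auto
  then have "distinct_adj a"
    using snoc.IH[of "conj_s b y"] snoc.prems by auto
  moreover have "last a \<noteq> b" if "a \<noteq> []"
  proof
    assume "last a = b"
    then have "butlast a @ [b] \<in> fpf_words (conj_s b y)"
      using b(2) that by (metis append_butlast_last_id)
    then have "desc_at b (conj_s b y)"
      using fpf_words_snoc[OF FPF_Z_conj_s[OF snoc.prems(1)]] by blast
    then show False
      using desc_at_conj_s[OF snoc.prems(1)] asc_not_desc b(1) by blast
  qed
  ultimately show ?case
    by (auto simp: distinct_adj_append_iff)
qed simp

section \<open>Words with compatible indices as sublists of the list of letters\<close>

definition before :: "nat \<times> int \<Rightarrow> nat \<times> int \<Rightarrow> bool" where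
  "before = (\<lambda>(k, a) (k', a'). k < k' \<or> k = k' \<and> a' < a)"

lemma transp_before: "transp before"
  by (auto simp: transp_def before_def)

lemma before_asym: "before x y \<Longrightarrow> \<not> before y x"
  by (auto simp: before_def)

text \<open>When \<open>L\<close> is decreasing for \<open>before\<close>, the lists
  \<open>zs\<close> are sublists of \<open>L\<close> read backwards.\<close>

definition word_set :: "(nat \<times> int) list \<Rightarrow> (nat \<Rightarrow> nat) \<Rightarrow> (int \<Rightarrow> int) \<Rightarrow> (nat \<times> int) list set" where
  "word_set L \<alpha> y = {zs. set zs \<subseteq> set L \<and> sorted_wrt before zs \<and> map snd zs \<in> fpf_words y \<and>
     (\<forall>k. count_list (map fst zs) k = \<alpha> k)}"

text \<open>The head \<open>(k, a)\<close> comes after all of \<open>L\<close> in the order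
  \<open>before\<close>, so if it is used it is the last entry, occurs once, and is stripped by
  \<open>fpf_words_snoc\<close>. This is the recursion of \<open>add_letter\<close>.\<close>

lemma word_set_Cons:
  assumes L: "sorted_wrt (\<lambda>x x'. before x' x) ((k, a) # L)" and y: "y \<in> FPF_Z"
  shows "word_set ((k, a) # L) \<alpha> y = word_set L \<alpha> y \<union>
    (if desc_at a y \<and> 0 < \<alpha> k then (\<lambda>zs. zs @ [(k, a)]) ` word_set L (\<alpha>(k := \<alpha> k - 1)) (conj_s a y) else {})"
    (is "?A = ?B \<union> ?C")
proof
  have before: "before x (k, a)" if "x \<in> set L" for x
    using L that by auto
  show "?A \<subseteq> ?B \<union> ?C"
  proof
    fix zs assume zs: "zs \<in> ?A"
    show "zs \<in> ?B \<union> ?C"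
    proof (cases "(k, a) \<in> set zs")
      case False
      then show ?thesis
        using zs by (auto simp: word_set_def)
    next
      case True
      then obtain us vs where split: "zs = us @ (k, a) # vs"
        by (meson split_list)
      have sorted: "sorted_wrt before us" "\<forall>x\<in>set us. before x (k, a)" "\<forall>x\<in>set vs. before (k, a) x"
        using zs by (auto simp: word_set_def split sorted_wrt_append)
      have "x \<in> set L" if "x \<in> set us \<union> set vs" for x
        using that zs sorted before_asym[of "(k, a)" "(k, a)"] by (auto simp: word_set_def split)
      \<comment> \<open>An entry of \<open>vs\<close> would lie in \<open>L\<close>, hence before
        \<open>(k, a)\<close>, yet also after it.\<close>
      then have "set us \<subseteq> set L" "vs = []"
        using sorted(3) before before_asym by (auto, metis UnI2 list.set_intros(1) neq_Nil_conv)
      moreover have "desc_at a y" "map snd us \<in> fpf_words (conj_s a y)"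
        using zs fpf_words_snoc[OF y, of "map snd us" a] \<open>vs = []\<close> by (auto simp: word_set_def split)
      moreover have c: "count_list (map fst us) j + (if j = k then 1 else 0) = \<alpha> j" for j
      proof -
        have "count_list (map fst zs) j = \<alpha> j"
          using zs by (simp add: word_set_def)
        then show ?thesis
          unfolding split \<open>vs = []\<close> by (simp split: if_splits)
      qed
      have "0 < \<alpha> k"
        using c[of k] by simp
      moreover have "count_list (map fst us) j = (\<alpha>(k := \<alpha> k - 1)) j" for j
        using c[of j] by auto
      ultimately show ?thesis
        using sorted(1) by (auto simp: word_set_def split)
    qed
  qed
  show "?B \<union> ?C \<subseteq> ?A"
  proof
    fix zs assume "zs \<in> ?B \<union> ?C"
    then consider "zs \<in> ?B" | us where "desc_at a y" "0 < \<alpha> k" "zs = us @ [(k, a)]"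
        "us \<in> word_set L (\<alpha>(k := \<alpha> k - 1)) (conj_s a y)"
      by (auto split: if_splits)
    then show "zs \<in> ?A"
    proof cases
      case 1
      then show ?thesis by (auto simp: word_set_def)
    next
      case 2
      then have "map snd zs \<in> fpf_words y"
        using fpf_words_snoc[OF y, of "map snd us" a] by (simp add: word_set_def)
      moreover have "sorted_wrt before zs" "set zs \<subseteq> set ((k, a) # L)"
        using 2 before by (auto simp: word_set_def sorted_wrt_append)
      moreover have "count_list (map fst zs) j = \<alpha> j" for j
        using 2 by (auto simp: word_set_def)
      ultimately show ?thesis
        by (simp add: word_set_def)
    qed
  qed
qed

lemma card_word_set:
  assumes "sorted_wrt (\<lambda>x x'. before x' x) L" "y \<in> FPF_Z"
  shows "finite (word_set L \<alpha> y) \<and> int (card (word_set L \<alpha> y)) = word_count L \<alpha> y"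
  using assms
proof (induction L arbitrary: \<alpha> y)
  case Nil
  have "(\<forall>k. count_list (map fst ([] :: (nat \<times> int) list)) k = \<alpha> k) \<longleftrightarrow> \<alpha> = (\<lambda>_. 0)"
    by (auto simp: fun_eq_iff)
  then have "word_set [] \<alpha> y = (if y = Theta \<and> \<alpha> = (\<lambda>_. 0) then {[]} else {})"
    using fpf_words_Nil[OF Nil(2)] by (auto simp: word_set_def)
  then show ?case
    by simp
next
  case (Cons x L)
  obtain k a where x: "x = (k, a)"
    by fastforce
  have L: "sorted_wrt (\<lambda>x x'. before x' x) L"
    using Cons.prems by simp
  have IH: "finite (word_set L \<alpha> y)" "int (card (word_set L \<alpha> y)) = word_count L \<alpha> y"
    if "y \<in> FPF_Z" for \<alpha> y
    using Cons.IH[OF L that] by auto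
  let ?C = "if desc_at a y \<and> 0 < \<alpha> k then (\<lambda>zs. zs @ [(k, a)]) ` word_set L (\<alpha>(k := \<alpha> k - 1)) (conj_s a y) else {}"
  have set: "word_set (x # L) \<alpha> y = word_set L \<alpha> y \<union> ?C"
    unfolding x by (rule word_set_Cons[OF Cons.prems[unfolded x]])
  have fin: "finite ?C"
    using IH(1) Cons.prems(2) by simp
  have "x \<notin> set L"
    using Cons.prems(1) before_asym[of x x] by auto
  then have "word_set L \<alpha> y \<inter> ?C = {}"
    by (auto simp: word_set_def x split: if_splits)
  then have "int (card (word_set (x # L) \<alpha> y)) = word_count L \<alpha> y + int (card ?C)"
    unfolding set using IH[OF Cons.prems(2)] fin by (simp add: card_Un_disjoint)
  also have "int (card ?C) = peel a (lower k (word_count L) \<alpha>) y"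
    using IH(2) Cons.prems(2) by (simp add: card_image inj_on_def peel_def lower_def)
  finally have "int (card (word_set (x # L) \<alpha> y)) = word_count (x # L) \<alpha> y"
    by (simp add: add_letter_def x)
  moreover have "finite (word_set (x # L) \<alpha> y)"
    unfolding set using IH(1)[OF Cons.prems(2)] fin by (rule finite_UnI)
  ultimately show ?case
    by blast
qed

lemma set_letters: "set (letters n m) = {1..m} \<times> {- 2 * int n..2 * int n}"
  by (induction m) auto

lemma sorted_letters: "sorted_wrt (\<lambda>x x'. before x' x) (letters n m)"
proof (induction m)
  case (Suc m)
  have "sorted_wrt (<) [i..j]" for i j
    by (induction i j rule: upto.induct) (subst upto.simps, auto)
  then have "sorted_wrt (\<lambda>x x'. before x' x) (map (Pair (Suc m)) [- 2 * int n..2 * int n])"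
    by (simp add: sorted_wrt_map before_def)
  then show ?case
    using Suc by (auto simp: sorted_wrt_append set_letters before_def)
qed simp

text \<open>Since \<open>before\<close> is transitive, only neighbours matter; and as neighbouring
  letters differ, letters sharing an index must descend.\<close>

lemma sorted_zip_iff_compatible:
  assumes "length i = length a" "distinct_adj a"
  shows "sorted_wrt before (zip i a) \<and> (\<forall>k\<in>set i. 0 < k) \<longleftrightarrow> compatible a i"
proof -
  have "sorted_wrt before (zip i a) \<longleftrightarrow>
    (\<forall>j. Suc j < length a \<longrightarrow> i ! j < i ! Suc j \<or> i ! j = i ! Suc j \<and> a ! Suc j < a ! j)"
    unfolding sorted_wrt_iff_nth_Suc_transp[OF transp_before] using assms(1) by (simp add: before_def)
  moreover have "sorted i \<longleftrightarrow> (\<forall>j. Suc j < length a \<longrightarrow> i ! j \<le> i ! Suc j)"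
    using assms(1) by (simp add: sorted_iff_nth_Suc)
  moreover have "i ! j < i ! Suc j \<or> i ! j = i ! Suc j \<and> a ! Suc j < a ! j \<longleftrightarrow>
      i ! j \<le> i ! Suc j \<and> (a ! j < a ! Suc j \<longrightarrow> i ! j < i ! Suc j)" if "Suc j < length a" for j
  proof -
    have "a ! j \<noteq> a ! Suc j"
      using assms(2) that by (simp add: distinct_adj_conv_nth)
    then show ?thesis
      by linarith
  qed
  ultimately show ?thesis
    using assms(1) unfolding compatible_def by metis
qed

section \<open>Coefficients of the symmetric functions as counts of words\<close>

lemma FPF_coeff_card:
  assumes z: "z \<in> FPF_Z"
  shows "FPF_coeff z \<alpha> = card {(a, i). a \<in> fpf_words z \<and> compatible a i \<and> (\<forall>k. count_list i k = \<alpha> k)}"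
proof -
  let ?T = "\<lambda>w. {(a, i). reduced_word w a \<and> compatible a i \<and> (\<forall>k. count_list i k = \<alpha> k)}"
  let ?U = "{(a, i). a \<in> fpf_words z \<and> compatible a i \<and> (\<forall>k. count_list i k = \<alpha> k)}"
  obtain n where n: "fpf_on n z"
    using FPF_Z_fpf_on[OF z] .
  have "fpf_words z \<subseteq> {a. set a \<subseteq> window n \<and> length a = card (inv_FPF z) div 2}"
    using fpf_words_letters[OF z n] by (auto simp: fpf_words_def)
  then have fin: "finite (fpf_words z)"
    by (rule finite_subset) (simp add: finite_lists_length_eq)
  \<comment> \<open>If some pair exists, its index list shows that \<open>\<alpha>\<close> has
    finite support; all index lists then use that support and have the same length.\<close>
  have finU: "finite ?U"
  proof (cases "?U = {}")
    case False
    then obtain i where i: "\<And>k. count_list i k = \<alpha> k"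
      by auto
    have supp: "set j = {k. \<alpha> k \<noteq> 0}" if "\<And>k. count_list j k = \<alpha> k" for j
      unfolding that[symmetric] by (auto simp: count_list_0_iff)
    have "?U \<subseteq> fpf_words z \<times> {j. set j \<subseteq> {k. \<alpha> k \<noteq> 0} \<and> length j = card (inv_FPF z) div 2}"
      using supp by (auto simp: fpf_words_def compatible_def)
    moreover have "finite {k. \<alpha> k \<noteq> 0}"
      using supp[OF i] by (metis List.finite_set)
    then have "finite (fpf_words z \<times> {j. set j \<subseteq> {k. \<alpha> k \<noteq> 0} \<and> length j = card (inv_FPF z) div 2})"
      by (intro finite_cartesian_product fin finite_lists_length_eq)
    ultimately show ?thesis
      by (rule finite_subset)
  qed (metis finite.emptyI)
  have union: "(\<Union>w\<in>A_FPF z. ?T w) = ?U"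
    using reduced_words_A_FPF[OF z] by auto
  have "A_FPF z \<subseteq> word_prod ` fpf_words z"
  proof
    fix w assume w: "w \<in> A_FPF z"
    then obtain a where "reduced_word w a"
      using reduced_word_exists unfolding A_FPF_def by blast
    then show "w \<in> word_prod ` fpf_words z"
      using reduced_words_A_FPF[OF z] w by blast
  qed
  then have finA: "finite (A_FPF z)"
    using fin finite_subset by blast
  have "FPF_coeff z \<alpha> = (\<Sum>w\<in>A_FPF z. card (?T w))"
    by (simp add: FPF_coeff_def stanley_coeff_def)
  also have "\<dots> = card (\<Union>w\<in>A_FPF z. ?T w)"
  proof (rule card_UN_disjoint[symmetric, OF finA])
    show "\<forall>w\<in>A_FPF z. finite (?T w)"
      using finU union by (metis (no_types, lifting) UN_upper finite_subset)
    show "\<forall>v\<in>A_FPF z. \<forall>w\<in>A_FPF z. v \<noteq> w \<longrightarrow> ?T v \<inter> ?T w = {}"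
      by (auto simp: reduced_word_def)
  qed
  finally show ?thesis
    unfolding union .
qed

text \<open>The pair \<open>(a, i)\<close> corresponds to the list \<open>zip i a\<close>; the
  window bounds its letters and the support of \<open>\<alpha>\<close> bounds its indices, so its
  entries lie in \<open>letters n m\<close>.\<close>

lemma FPF_coeff_word_count:
  assumes z: "z \<in> FPF_Z" and n: "fpf_on n z" and \<alpha>: "\<And>k. \<alpha> k \<noteq> 0 \<Longrightarrow> k \<in> {1..m}"
  shows "int (FPF_coeff z \<alpha>) = word_count (letters n m) \<alpha> z"
proof -
  let ?U = "{(a, i). a \<in> fpf_words z \<and> compatible a i \<and> (\<forall>k. count_list i k = \<alpha> k)}"
  let ?V = "word_set (letters n m) \<alpha> z" and ?f = "\<lambda>zs :: (nat \<times> int) list. (map snd zs, map fst zs)"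
  have "?f ` ?V = ?U"
  proof
    show "?f ` ?V \<subseteq> ?U"
    proof
      fix x assume "x \<in> ?f ` ?V"
      then obtain zs where zs: "zs \<in> ?V" "x = ?f zs"
        by blast
      then have "distinct_adj (map snd zs)"
        using fpf_words_distinct_adj[OF z] by (simp add: word_set_def)
      moreover have "zip (map fst zs) (map snd zs) = zs"
        by (simp add: zip_map_fst_snd)
      moreover have "\<forall>k\<in>set (map fst zs). 0 < k"
        using zs(1) by (auto simp: word_set_def set_letters)
      ultimately have "compatible (map snd zs) (map fst zs)"
        using sorted_zip_iff_compatible[of "map fst zs" "map snd zs"] zs(1) by (simp add: word_set_def)
      then show "x \<in> ?U"
        using zs by (simp add: word_set_def)
    qed
    show "?U \<subseteq> ?f ` ?V"
    proof
      fix x assume "x \<in> ?U"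
      then obtain a i where x: "x = (a, i)" "a \<in> fpf_words z" "compatible a i" "\<And>k. count_list i k = \<alpha> k"
        by auto
      have len: "length i = length a"
        using x(3) by (simp add: compatible_def)
      have "k \<in> {1..m}" if "k \<in> set i" for k
        using \<alpha>[of k] x(4)[of k] that by (metis count_list_0_iff)
      moreover have "set a \<subseteq> {- 2 * int n..2 * int n}"
        using fpf_words_letters[OF z n x(2)] by (auto simp: window_def)
      ultimately have "set (zip i a) \<subseteq> set (letters n m)"
        unfolding set_letters by (auto dest: set_zip_leftD set_zip_rightD)
      moreover have "sorted_wrt before (zip i a)"
        using sorted_zip_iff_compatible[OF len] fpf_words_distinct_adj[OF z x(2)] x(3) by simp
      ultimately have "zip i a \<in> ?V"
        using x len by (simp add: word_set_def)
      moreover have "x = ?f (zip i a)"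
        using x(1) len by simp
      ultimately show "x \<in> ?f ` ?V"
        by blast
    qed
  qed
  moreover have "inj_on ?f ?V"
    by (rule inj_on_inverseI[where g = "\<lambda>(a, i). zip i a"]) (simp add: zip_map_fst_snd)
  ultimately have "FPF_coeff z \<alpha> = card ?V"
    using card_image[of ?f ?V] FPF_coeff_card[OF z] by simp
  then show ?thesis
    using card_word_set[OF sorted_letters z] by simp
qed

text \<open>\<open>\<alpha>\<close> ranges over all functions, including those of infinite support
  or nonzero at 0; a finite list of positive indices cannot realise them.\<close>

lemma FPF_coeff_unsupported:
  assumes z: "z \<in> FPF_Z" and \<alpha>: "\<nexists>m. \<forall>k. \<alpha> k \<noteq> 0 \<longrightarrow> k \<in> {1..m}"
  shows "FPF_coeff z \<alpha> = 0"
proof -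
  have False if "compatible a i" "\<And>k. count_list i k = \<alpha> k" for a i
  proof -
    have "k \<in> {1..Max (set i)}" if "\<alpha> k \<noteq> 0" for k
    proof -
      have "k \<in> set i"
        using that \<open>\<And>k. count_list i k = \<alpha> k\<close> by (metis count_list_0_iff)
      then show ?thesis
        using \<open>compatible a i\<close> by (auto simp: compatible_def Suc_le_eq)
    qed
    then show False
      using \<alpha> by blast
  qed
  then have "{(a, i). a \<in> fpf_words z \<and> compatible a i \<and> (\<forall>k. count_list i k = \<alpha> k)} = {}"
    by blast
  then show ?thesis
    unfolding FPF_coeff_card[OF z] by (metis card.empty)
qed

theorem theorem2p12:
  fixes y :: "int \<Rightarrow> int" and p q :: int
  assumes "y \<in> FPF_Z" and "y p = q" and "p < q"
  shows "(\<lambda>\<alpha>. \<Sum>z\<in>Psi_minus y p. FPF_coeff z \<alpha>) = (\<lambda>\<alpha>. \<Sum>z\<in>Psi_plus y q. FPF_coeff z \<alpha>)"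
proof
  fix \<alpha>
  let ?S = "\<lambda>b. covers b y p"
  have FPF: "z \<in> FPF_Z" if "z \<in> ?S b" for z b
    using covers_FPF[OF assms(1) that] .
  have "(\<Sum>z\<in>?S False. FPF_coeff z \<alpha>) = (\<Sum>z\<in>?S True. FPF_coeff z \<alpha>)"
  proof (cases "\<exists>m. \<forall>k. \<alpha> k \<noteq> 0 \<longrightarrow> k \<in> {1..m}")
    case False
    then have "(\<Sum>z\<in>?S b. FPF_coeff z \<alpha>) = 0" for b
      using FPF_coeff_unsupported FPF by simp
    then show ?thesis by simp
  next
    case True
    then obtain m where m: "\<And>k. \<alpha> k \<noteq> 0 \<Longrightarrow> k \<in> {1..m}"
      by blast
    obtain n0 where n0: "fpf_on n0 y" "p \<in> window n0"
      using fpf_on_large[OF assms(1)] by blast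
    have "\<forall>z\<in>?S True \<union> ?S False. \<exists>n. fpf_on n z"
      using FPF FPF_Z_fpf_on by (metis Un_iff)
    then obtain N where N: "\<And>z. z \<in> ?S True \<union> ?S False \<Longrightarrow> fpf_on (N z) z"
      by metis
    \<comment> \<open>One window for \<open>y\<close> and its finitely many covers, so that a single
      list of letters computes all the coefficients.\<close>
    define n where "n = Max (insert n0 (N ` (?S True \<union> ?S False)))"
    have fin: "finite (insert n0 (N ` (?S True \<union> ?S False)))"
      using finite_covers[OF assms(1)] by simp
    have y: "fpf_on n y" "p \<in> window n"
      using fpf_on_mono[OF n0(1), of n] window_mono[of n0 n] n0(2) Max_ge[OF fin, of n0]
      unfolding n_def by auto
    have "fpf_on n z" if "z \<in> ?S b" for z b
    proof -
      have z: "z \<in> ?S True \<union> ?S False"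
        using that by (cases b) auto
      then have "N z \<le> n"
        unfolding n_def by (intro Max_ge fin) blast
      then show ?thesis
        using fpf_on_mono[OF N[OF z]] by simp
    qed
    then have "int (\<Sum>z\<in>?S b. FPF_coeff z \<alpha>) = (\<Sum>z\<in>?S b. word_count (letters n m) \<alpha> z)" for b
      unfolding of_nat_sum using FPF m by (intro sum.cong FPF_coeff_word_count) auto
    then show ?thesis
      using transition_letters[OF assms(1) y, of m \<alpha>] unfolding transition_def by (metis eq_iff_diff_eq_0 of_nat_eq_iff)
  qed
  then show "(\<Sum>z\<in>Psi_minus y p. FPF_coeff z \<alpha>) = (\<Sum>z\<in>Psi_plus y q. FPF_coeff z \<alpha>)"
    unfolding Psi_plus_covers[OF assms] Psi_minus_covers[OF assms] .
qed

end
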